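(* In the setting of the context, let $p^*$ be the reverse process whose means and variances minimize $D_{\mathrm{KL}}\big(q(\mathbf{x}_0,\mathbf{x}_{\tau_1},\dots,\mathbf{x}_{\tau_K})\,\|\,p(\mathbf{x}_0,\mathbf{x}_{\tau_1},\dots,\mathbf{x}_{\tau_K})\big)$. Then $$D_{\mathrm{KL}}\big(q(\mathbf{x}_0,\mathbf{x}_{\tau_1},\dots,\mathbf{x}_{\tau_K})\,\|\,p^*(\mathbf{x}_0,\mathbf{x}_{\tau_1},\dots,\mathbf{x}_{\tau_K})\big)=\frac d2\sum_{k=2}^K J(\tau_{k-1},\tau_k)+c,$$ where $J(\tau_{k-1},\tau_k)=\log\big(\sigma^{*2}_{\tau_{k-1}|\tau_k}/\lambda^2_{\tau_{k-1}|\tau_k}\big)$ and $c$ is a constant that does not depend on the trajectory $\tau$.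
   Context: Let $d,N\ge1$, $\beta_1,\dots,\beta_N\in(0,1)$, $\alpha_n=1-\beta_n$, $\overline{\alpha}_n=\prod_{i\le n}\alpha_i$, $\overline{\beta}_n=1-\overline{\alpha}_n$. Let $q(\mathbf{x}_0)$ be a probability density on $\mathbb{R}^d$ with finite second moments. A trajectory is $1=\tau_1<\dots<\tau_K=N$; set $\tau_0:=0$. For $2\le k\le K$ let $\lambda_{\tau_{k-1}|\tau_k}$ satisfy $0<\lambda^2_{\tau_{k-1}|\tau_k}\le\overline{\beta}_{\tau_{k-1}}$, and let $\alpha_{\tau_k|\tau_{k-1}}:=\overline{\alpha}_{\tau_k}/\overline{\alpha}_{\tau_{k-1}}$, $\tilde{\boldsymbol{\mu}}_{\tau_{k-1}|\tau_k}(\mathbf{x}_{\tau_k},\mathbf{x}_0):=\sqrt{\overline{\alpha}_{\tau_{k-1}}}\mathbf{x}_0+\sqrt{\overline{\beta}_{\tau_{k-1}}-\lambda^2_{\tau_{k-1}|\tau_k}}\,\frac{\mathbf{x}_{\tau_k}-\sqrt{\overline{\alpha}_{\tau_k}}\mathbf{x}_0}{\sqrt{\overline{\beta}_{\tau_k}}}$. The forward process is $q(\mathbf{x}_0,\mathbf{x}_{\tau_1},\dots,\mathbf{x}_{\tau_K})=q(\mathbf{x}_0)q(\mathbf{x}_{\tau_K}|\mathbf{x}_0)\prod_{k=2}^Kq(\mathbf{x}_{\tau_{k-1}}|\mathbf{x}_{\tau_k},\mathbf{x}_0)$ with $q(\mathbf{x}_{\tau_K}|\mathbf{x}_0)=\mathcal{N}(\sqrt{\overline{\alpha}_N}\mathbf{x}_0,\overline{\beta}_N\mathbf{I})$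 and $q(\mathbf{x}_{\tau_{k-1}}|\mathbf{x}_{\tau_k},\mathbf{x}_0)=\mathcal{N}(\tilde{\boldsymbol{\mu}}_{\tau_{k-1}|\tau_k}(\mathbf{x}_{\tau_k},\mathbf{x}_0),\lambda^2_{\tau_{k-1}|\tau_k}\mathbf{I})$; then $q(\mathbf{x}_n|\mathbf{x}_0)=\mathcal{N}(\sqrt{\overline{\alpha}_n}\mathbf{x}_0,\overline{\beta}_n\mathbf{I})$ and $q_n$ denotes the marginal of $\mathbf{x}_n$. The reverse process is $p(\mathbf{x}_0,\mathbf{x}_{\tau_1},\dots,\mathbf{x}_{\tau_K})=p(\mathbf{x}_{\tau_K})\prod_{k=1}^Kp(\mathbf{x}_{\tau_{k-1}}|\mathbf{x}_{\tau_k})$ with $p(\mathbf{x}_{\tau_K})=\mathcal{N}(\mathbf{0},\mathbf{I})$ and $p(\mathbf{x}_{\tau_{k-1}}|\mathbf{x}_{\tau_k})=\mathcal{N}(\boldsymbol{\mu}_{\tau_{k-1}|\tau_k}(\mathbf{x}_{\tau_k}),\sigma^2_{\tau_{k-1}|\tau_k}\mathbf{I})$ with free means and variances. The optimal variance is $\sigma^{*2}_{\tau_{k-1}|\tau_k}=\lambda^2_{\tau_{k-1}|\tau_k}+\Big(\sqrt{\tfrac{\overline{\beta}_{\tau_k}}{\alpha_{\tau_k|\tau_{k-1}}}}-\sqrt{\overline{\beta}_{\tau_{k-1}}-\lambda^2_{\tau_{k-1}|\tau_k}}\Big)^2\Big(1-\overline{\beta}_{\tau_k}\mathbb{E}_{q_{\tau_k}}\frac{\|\nabla\log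 q_{\tau_k}(\mathbf{x}_{\tau_k})\|^2}{d}\Big)$.
   Formalization: The constant c is allowed to be +∞: this is needed when q(x_0) has differential entropy −∞, since the divergence is then infinite for every trajectory and reverse process; when the entropy is finite, c is finite. *)

theory Defs
  imports "HOL-Analysis.Analysis"
begin

definition abar :: "(nat \<Rightarrow> real) \<Rightarrow> nat \<Rightarrow> real" where
  "abar beta n = (\<Prod>i\<in>{1..n}. 1 - beta i)"

definition bbar :: "(nat \<Rightarrow> real) \<Rightarrow> nat \<Rightarrow> real" where
  "bbar beta n = 1 - abar beta n"

definition gauss_pdf :: "real^'d \<Rightarrow> real \<Rightarrow> real^'d \<Rightarrow> real" where
  "gauss_pdf m v x = (2 * pi * v) powr (- real CARD('d) / 2) * exp (- (norm (x - m))\<^sup>2 / (2 * v))"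

definition trajectory :: "nat \<Rightarrow> nat \<Rightarrow> (nat \<Rightarrow> nat) \<Rightarrow> bool" where
  "trajectory N K tau \<longleftrightarrow> 1 \<le> K \<and> tau 1 = 1 \<and> tau K = N \<and> (\<forall>k\<in>{1..<K}. tau k < tau (Suc k))"

text \<open>Mean of q(x_s | x_t, x_0), with lam s t = lambda_{s|t}.\<close>

definition mu_tilde :: "(nat \<Rightarrow> real) \<Rightarrow> (nat \<Rightarrow> nat \<Rightarrow> real) \<Rightarrow> nat \<Rightarrow> nat \<Rightarrow> real^'d \<Rightarrow> real^'d \<Rightarrow> real^'d" where
  "mu_tilde beta lam s t xt x0 =
     sqrt (abar beta s) *\<^sub>R x0
     + (sqrt (bbar beta s - (lam s t)\<^sup>2) / sqrt (bbar beta t)) *\<^sub>R (xt - sqrt (abar beta t) *\<^sub>R x0)"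

text \<open>Joint densities. A point x :: nat => real^'d encodes (x_0, x_{tau_1}, ..., x_{tau_K})
  as x 0 = x_0 and x k = x_{tau_k} for 1 <= k <= K.\<close>

definition fwd_joint :: "(nat \<Rightarrow> real) \<Rightarrow> (nat \<Rightarrow> nat \<Rightarrow> real) \<Rightarrow> nat \<Rightarrow> nat \<Rightarrow> (nat \<Rightarrow> nat)
    \<Rightarrow> (real^'d \<Rightarrow> real) \<Rightarrow> (nat \<Rightarrow> real^'d) \<Rightarrow> real" where
  "fwd_joint beta lam N K tau q0 x =
     q0 (x 0) * gauss_pdf (sqrt (abar beta N) *\<^sub>R x 0) (bbar beta N) (x K)
     * (\<Prod>k\<in>{2..K}. gauss_pdf (mu_tilde beta lam (tau (k - 1)) (tau k) (x k) (x 0))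
                                ((lam (tau (k - 1)) (tau k))\<^sup>2) (x (k - 1)))"

definition rev_joint :: "nat \<Rightarrow> (nat \<Rightarrow> real^'d \<Rightarrow> real^'d) \<Rightarrow> (nat \<Rightarrow> real) \<Rightarrow> (nat \<Rightarrow> real^'d) \<Rightarrow> real" where
  "rev_joint K mu sig x =
     gauss_pdf 0 1 (x K) * (\<Prod>k\<in>{1..K}. gauss_pdf (mu k (x k)) (sig k) (x (k - 1)))"

definition rev_params :: "nat \<Rightarrow> (nat \<Rightarrow> real^'d \<Rightarrow> real^'d) \<Rightarrow> (nat \<Rightarrow> real) \<Rightarrow> bool" where
  "rev_params K mu sig \<longleftrightarrow> (\<forall>k\<in>{1..K}. mu k \<in> borel_measurable borel \<and> 0 < sig k)"

definition KL_div :: "'a measure \<Rightarrow> ('a \<Rightarrow> real) \<Rightarrow> ('a \<Rightarrow> real) \<Rightarrow> ereal" where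
  "KL_div M f g =
     (if AE x in M. 0 < f x \<longrightarrow> 0 < g x
      then enn2ereal (\<integral>\<^sup>+ x. ennreal (f x * ln (f x / g x)) \<partial>M)
           - enn2ereal (\<integral>\<^sup>+ x. ennreal (- (f x * ln (f x / g x))) \<partial>M)
      else \<infinity>)"

definition marg :: "(nat \<Rightarrow> real) \<Rightarrow> (real^'d \<Rightarrow> real) \<Rightarrow> nat \<Rightarrow> real^'d \<Rightarrow> real" where
  "marg beta q0 n y = (\<integral> x. q0 x * gauss_pdf (sqrt (abar beta n) *\<^sub>R x) (bbar beta n) y \<partial>lborel)"

definition score :: "(real^'d \<Rightarrow> real) \<Rightarrow> real^'d \<Rightarrow> real^'d" where
  "score f y = (SOME D. GDERIV (\<lambda>z. ln (f z)) y :> D)"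

definition fisher :: "(nat \<Rightarrow> real) \<Rightarrow> (real^'d \<Rightarrow> real) \<Rightarrow> nat \<Rightarrow> real" where
  "fisher beta q0 n = (\<integral> y. marg beta q0 n y * (norm (score (marg beta q0 n) y))\<^sup>2 \<partial>lborel)"

text \<open>Optimal variance sigma*^2_{s|t} with alpha_{t|s} = abar_t / abar_s.\<close>

definition sigma_star_sq :: "(nat \<Rightarrow> real) \<Rightarrow> (nat \<Rightarrow> nat \<Rightarrow> real) \<Rightarrow> (real^'d \<Rightarrow> real) \<Rightarrow> nat \<Rightarrow> nat \<Rightarrow> real" where
  "sigma_star_sq beta lam q0 s t =
     (lam s t)\<^sup>2
     + (sqrt (bbar beta t / (abar beta t / abar beta s)) - sqrt (bbar beta s - (lam s t)\<^sup>2))\<^sup>2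
       * (1 - bbar beta t * fisher beta q0 t / real CARD('d))"

definition Jcost :: "(nat \<Rightarrow> real) \<Rightarrow> (nat \<Rightarrow> nat \<Rightarrow> real) \<Rightarrow> (real^'d \<Rightarrow> real) \<Rightarrow> nat \<Rightarrow> nat \<Rightarrow> real" where
  "Jcost beta lam q0 s t = ln (sigma_star_sq beta lam q0 s t / (lam s t)\<^sup>2)"

end

theory Submission
  imports Defs "HOL-Probability.Probability"
begin

text \<open>The log-ratio of the two joint densities is, up to constants, \<open>ln q0(x0)\<close> plus
  a combination of squared Gaussian deviations whose expectations are explicit, plus the terms
  \<open>|x(k-1) - mu k (x k)|^2 / (2 sig k)\<close>. Convolving the Gaussian kernels gives the joint law of
  \<open>(x0, x(k-1), x k)\<close>, and completing the square around the posterior mean of \<open>x0\<close> given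
  \<open>x k\<close> gives the least expected deviation; by Tweedie's formula it equals
  \<open>d sigma*^2\<close>. Since \<open>ln s + v / s\<close> is minimal at \<open>s = v\<close>, the divergence decouples over
  \<open>k\<close>. The term \<open>k = 1\<close> only involves \<open>q0\<close> and \<open>beta 1\<close>, as \<open>tau 1 = 1\<close>, so it goes into the
  constant together with the entropy of \<open>q0\<close>; the latter may be infinite, but only with the sign
  that makes every divergence infinite.\<close>

subsection \<open>Isotropic Gaussian densities\<close>

text \<open>\<open>KL_div\<close> is a difference of two extended integrals, so it can be evaluated
  only once the negative part is known to be finite; the reverse means, on the other hand, are
  arbitrary measurable functions and may make the positive part infinite. The log-ratio is therefore
  cut into an integrable \<open>R\<close> and a nonnegative \<open>Q\<close>, and whatever involves
  the means is computed with nonnegative extended integrals, where exchanging integrals and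
  completing squares need no integrability. The factor
  \<open>sqrt (bbar beta s - (lam s t)\<^sup>2)\<close> in \<open>mu_tilde\<close> makes the law of
  every point given \<open>x 0\<close> independent of \<open>lam\<close>, so each step sees
  \<open>lam\<close> only through its own kernel. The number \<open>K\<close> of steps varies with
  the trajectory. The forward quadratics contribute \<open>- K * d / 2\<close> in total, and the
  ratios of optimal to chosen variance, equal to 1 at the optimum, contribute
  \<open>K * d / 2\<close>; the terms at \<open>x K\<close> depend on \<open>N\<close> alone because
  \<open>tau K = N\<close>.\<close>

lemma gauss_pdf_nonneg: "0 \<le> gauss_pdf m v x"
  by (simp add: gauss_pdf_def)

lemma gauss_pdf_pos: "0 < v \<Longrightarrow> 0 < gauss_pdf m v x"
  by (simp add: gauss_pdf_def)

lemma gauss_pdf_nonzero: "0 < v \<Longrightarrow> gauss_pdf m v x \<noteq> 0"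
  using gauss_pdf_pos[of v m x] by simp

lemma ln_gauss_pdf:
  fixes x :: "real^'d"
  assumes "0 < v"
  shows "ln (gauss_pdf m v x) = - real CARD('d) / 2 * ln (2 * pi * v) - (norm (x - m))\<^sup>2 / (2 * v)"
  using assms by (simp add: gauss_pdf_def ln_mult ln_powr)

lemma borel_measurable_gauss_pdf [measurable]:
  assumes [measurable]: "f \<in> borel_measurable M" "g \<in> borel_measurable M"
  shows "(\<lambda>x. gauss_pdf (f x :: real^'d) v (g x)) \<in> borel_measurable M"
  unfolding gauss_pdf_def by measurable

lemma norm_diff_sq_Basis:
  fixes x y :: "'a::euclidean_space"
  shows "(norm (x - y))\<^sup>2 = (\<Sum>b\<in>Basis. (x \<bullet> b - y \<bullet> b)\<^sup>2)"
  by (subst power2_norm_eq_inner, subst euclidean_inner)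
    (simp add: power2_eq_square inner_diff_left)

text \<open>Reduces masses, moments and convolutions to the real line, one basis vector at a time.
  \<open>normal_density\<close> takes a standard deviation, hence \<open>sqrt v\<close>.\<close>

lemma gauss_pdf_eq_prod:
  fixes x :: "real^'d"
  assumes "0 < v"
  shows "gauss_pdf m v x = (\<Prod>b\<in>Basis. normal_density (m \<bullet> b) (sqrt v) (x \<bullet> b))"
proof -
  have "(2 * pi * v) powr (- real CARD('d) / 2) = ((2 * pi * v) powr (- 1 / 2)) powr real CARD('d)"
    by (simp add: powr_powr)
  also have "\<dots> = (1 / sqrt (2 * pi * v)) ^ CARD('d)"
    using assms by (simp add: powr_realpow powr_minus powr_half_sqrt field_simps)
  finally have "(2 * pi * v) powr (- real CARD('d) / 2) = (1 / sqrt (2 * pi * v)) ^ CARD('d)" .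
  then show ?thesis
    using assms
    by (simp add: gauss_pdf_def normal_density_def norm_diff_sq_Basis sum_divide_distrib
        prod_dividef power_one_over flip: sum_negf exp_sum)
qed

lemma nn_integral_normal_density:
  "0 < \<sigma> \<Longrightarrow> (\<integral>\<^sup>+x. ennreal (normal_density \<mu> \<sigma> x) \<partial>lborel) = 1"
  by (subst nn_integral_eq_integral) auto

lemma nn_integral_normal_density_sq:
  assumes s: "0 < \<sigma>"
  shows "(\<integral>\<^sup>+x. ennreal (normal_density \<mu> \<sigma> x * (x - a)\<^sup>2) \<partial>lborel) = ennreal (\<sigma>\<^sup>2 + (\<mu> - a)\<^sup>2)"
proof -
  have eq: "normal_density \<mu> \<sigma> x * (x - a)\<^sup>2 =
      normal_density \<mu> \<sigma> x * (x - \<mu>)^2 + (2 * (\<mu> - a)) * (normal_density \<mu> \<sigma> x * (x - \<mu>)^1)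
      + (\<mu> - a)\<^sup>2 * normal_density \<mu> \<sigma> x" for x
    by (simp add: power2_eq_square algebra_simps)
  have "has_bochner_integral lborel (\<lambda>x. normal_density \<mu> \<sigma> x * (x - a)\<^sup>2)
     (\<sigma>\<^sup>2 + (2 * (\<mu> - a)) * 0 + (\<mu> - a)\<^sup>2 * 1)"
    unfolding eq
    using normal_moment_even[OF s, of \<mu> 1] normal_moment_odd[OF s, of \<mu> 0] s
    by (intro has_bochner_integral_add has_bochner_integral_mult_right)
      (auto simp: has_bochner_integral_iff fact_numeral)
  then show ?thesis
    by (subst nn_integral_eq_integral) (auto simp: has_bochner_integral_iff)
qed

lemma nn_integral_gauss_pdf:
  fixes m :: "real^'d"
  assumes "0 < v"
  shows "(\<integral>\<^sup>+x. ennreal (gauss_pdf m v x) \<partial>lborel) = 1"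
proof -
  have "(\<integral>\<^sup>+x. ennreal (gauss_pdf m v x) \<partial>lborel)
      = (\<integral>\<^sup>+x. (\<Prod>b\<in>Basis. ennreal (normal_density (m \<bullet> b) (sqrt v) (x \<bullet> b))) \<partial>lborel)"
    using assms by (simp add: gauss_pdf_eq_prod prod_ennreal)
  also have "\<dots> = (\<Prod>b\<in>Basis. \<integral>\<^sup>+x. ennreal (normal_density (m \<bullet> b) (sqrt v) x) \<partial>lborel)"
    by (rule nn_integral_lborel_prod) auto
  finally show ?thesis
    using assms by (simp add: nn_integral_normal_density)
qed

text \<open>Bias and variance add up coordinatewise: each basis direction contributes
  \<open>v\<close> plus the squared offset of the mean from \<open>a\<close>.\<close>

lemma nn_integral_gauss_pdf_sq:
  fixes m :: "real^'d"
  assumes v: "0 < v"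
  shows "(\<integral>\<^sup>+x. ennreal (gauss_pdf m v x * (norm (x - a))\<^sup>2) \<partial>lborel)
       = ennreal (v * real CARD('d) + (norm (m - a))\<^sup>2)"
proof -
  \<comment> \<open>The square sits on the single coordinate \<open>c\<close>, so the integrand is
    still a product over the basis.\<close>
  define F where "F c b x = normal_density (m \<bullet> b) (sqrt v) x * (if b = c then (x - a \<bullet> b)\<^sup>2 else 1)"
    for b c :: "real^'d" and x
  have F0: "0 \<le> F c b x" for c b x by (simp add: F_def)
  have [measurable]: "F c b \<in> borel_measurable borel" for c b
    unfolding F_def by measurable
  have 1: "gauss_pdf m v x * (x \<bullet> c - a \<bullet> c)\<^sup>2 = (\<Prod>b\<in>Basis. F c b (x \<bullet> b))"
    if "c \<in> Basis" for c x
    using that v by (simp add: F_def gauss_pdf_eq_prod prod.distrib prod.delta)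
  have 2: "(\<integral>\<^sup>+x. ennreal (gauss_pdf m v x * (x \<bullet> c - a \<bullet> c)\<^sup>2) \<partial>lborel)
      = ennreal (v + (m \<bullet> c - a \<bullet> c)\<^sup>2)" if c: "c \<in> Basis" for c
  proof -
    have "(\<integral>\<^sup>+x. ennreal (gauss_pdf m v x * (x \<bullet> c - a \<bullet> c)\<^sup>2) \<partial>lborel)
      = (\<integral>\<^sup>+x. (\<Prod>b\<in>Basis. ennreal (F c b (x \<bullet> b))) \<partial>lborel)"
      using c by (simp add: 1 prod_ennreal F0)
    also have "\<dots> = (\<Prod>b\<in>Basis. \<integral>\<^sup>+x. ennreal (F c b x) \<partial>lborel)"
      by (rule nn_integral_lborel_prod) auto
    also have "\<dots> = (\<Prod>b\<in>Basis. if b = c then ennreal (v + (m \<bullet> b - a \<bullet> b)\<^sup>2) else 1)"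
      using v nn_integral_normal_density_sq[of "sqrt v" "m \<bullet> c" "a \<bullet> c"]
      by (intro prod.cong refl) (auto simp: F_def nn_integral_normal_density)
    finally show ?thesis using c by (simp add: prod.delta)
  qed
  have "(\<integral>\<^sup>+x. ennreal (gauss_pdf m v x * (norm (x - a))\<^sup>2) \<partial>lborel)
     = (\<integral>\<^sup>+x. (\<Sum>c\<in>Basis. ennreal (gauss_pdf m v x * (x \<bullet> c - a \<bullet> c)\<^sup>2)) \<partial>lborel)"
    by (simp add: norm_diff_sq_Basis sum_distrib_left sum_ennreal gauss_pdf_nonneg)
  also have "\<dots> = (\<Sum>c\<in>Basis. ennreal (v + (m \<bullet> c - a \<bullet> c)\<^sup>2))"
    by (subst nn_integral_sum) (auto simp: 2)
  also have "\<dots> = ennreal (v * real CARD('d) + (norm (m - a))\<^sup>2)"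
    using v by (subst sum_ennreal) (auto simp: norm_diff_sq_Basis sum.distrib mult.commute simp del: ennreal_plus)
  finally show ?thesis .
qed

text \<open>Bayes' rule for Gaussians, by completing the square in \<open>x\<close>: the joint
  density of \<open>x\<close> and \<open>y\<close> is the marginal of \<open>y\<close>, with
  variance \<open>S\<close>, times the posterior of \<open>x\<close> given \<open>y\<close>, with
  variance \<open>v * w / S\<close>.\<close>

lemma normal_density_mult:
  fixes c m x e y v w :: real
  assumes v: "0 < v" and w: "0 < w"
  defines "S \<equiv> c\<^sup>2 * v + w"
  shows "normal_density m (sqrt v) x * normal_density (c * x + e) (sqrt w) y
    = normal_density (c * m + e) (sqrt S) y
      * normal_density ((m * w + c * v * (y - e)) / S) (sqrt (v * w / S)) x"
proof -
  have S: "0 < S" using v w by (simp add: S_def add_nonneg_pos)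
  have e: "(x - m)\<^sup>2 / (2 * v) + (y - (c * x + e))\<^sup>2 / (2 * w)
     = (y - (c * m + e))\<^sup>2 / (2 * S) + (x - (m * w + c * v * (y - e)) / S)\<^sup>2 / (2 * (v * w / S))"
  proof -
    \<comment> \<open>In the centred variables \<open>z\<close> and \<open>u\<close> both sides
      become quadratic forms with the parameters \<open>c\<close>, \<open>v\<close>,
      \<open>w\<close> only.\<close>
    define z where "z = y - c * m - e"
    define u where "u = x - m"
    have a: "y - (c * x + e) = z - c * u" "y - (c * m + e) = z"
      by (auto simp: z_def u_def algebra_simps)
    have b: "x - (m * w + c * v * (y - e)) / S = u - c * v * z / S"
      using S by (simp add: z_def u_def S_def field_simps power2_eq_square)
    have c: "(u - c * v * z / S)\<^sup>2 = (u * S - c * v * z)\<^sup>2 / S\<^sup>2"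
      using S by (simp add: field_simps power2_eq_square)
    have "u\<^sup>2 / (2 * v) + (z - c * u)\<^sup>2 / (2 * w) = (u\<^sup>2 * w + (z - c * u)\<^sup>2 * v) / (2 * v * w)"
      using v w by (simp add: field_simps)
    also have "u\<^sup>2 * w + (z - c * u)\<^sup>2 * v = (z\<^sup>2 * v * w + (u * S - c * v * z)\<^sup>2) / S"
      using S by (simp add: eq_divide_eq) (simp add: S_def power2_eq_square algebra_simps)
    also have "\<dots> / (2 * v * w) = z\<^sup>2 / (2 * S) + (u * S - c * v * z)\<^sup>2 / S\<^sup>2 / (2 * (v * w / S))"
      using v w S by (simp add: field_simps power2_eq_square)
    finally show ?thesis
      unfolding a b c u_def[symmetric] .
  qed
  have s: "sqrt (2 * pi * v) * sqrt (2 * pi * w) = sqrt (2 * pi * S) * sqrt (2 * pi * (v * w / S))"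
    using S by (simp add: real_sqrt_mult[symmetric])
  have nd: "normal_density \<mu> (sqrt a) z = exp (- ((z - \<mu>)\<^sup>2 / (2 * a))) / sqrt (2 * pi * a)" if "0 < a" for \<mu> a z :: real
    using that by (simp add: normal_density_def)
  have vwS: "0 < v * w / S" using v w S by simp
  show ?thesis
    unfolding nd[OF v] nd[OF w] nd[OF S] nd[OF vwS] times_divide_times_eq mult_exp_exp s
      minus_add_distrib[symmetric] e ..
qed

text \<open>After the factorization into marginal and posterior, the posterior has mass 1 and only
  the marginal of \<open>y\<close> is left.\<close>

lemma nn_integral_gauss_pdf_mult:
  fixes m :: "real^'d"
  assumes v: "0 < v" and w: "0 < w"
  shows "(\<integral>\<^sup>+x. ennreal (gauss_pdf m v x) * ennreal (gauss_pdf (c *\<^sub>R x + e) w y) \<partial>lborel)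
       = ennreal (gauss_pdf (c *\<^sub>R m + e) (c\<^sup>2 * v + w) y)"
proof -
  define S where "S = c\<^sup>2 * v + w"
  have S: "0 < S" using v w by (simp add: S_def add_nonneg_pos)
  define m' where "m' = (1 / S) *\<^sub>R (w *\<^sub>R m + (c * v) *\<^sub>R (y - e))"
  have "gauss_pdf m v x * gauss_pdf (c *\<^sub>R x + e) w y
      = gauss_pdf (c *\<^sub>R m + e) S y * gauss_pdf m' (v * w / S) x" for x
    unfolding gauss_pdf_eq_prod[OF v] gauss_pdf_eq_prod[OF w] gauss_pdf_eq_prod[OF S]
      gauss_pdf_eq_prod[OF divide_pos_pos[OF mult_pos_pos[OF v w] S]] prod.distrib[symmetric]
    using normal_density_mult[OF v w, of "m \<bullet> _" "x \<bullet> _" c "e \<bullet> _" "y \<bullet> _", folded S_def]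
    by (intro prod.cong refl)
      (simp add: inner_add_left m'_def inner_diff_left mult.commute)
  then have "(\<integral>\<^sup>+x. ennreal (gauss_pdf m v x) * ennreal (gauss_pdf (c *\<^sub>R x + e) w y) \<partial>lborel)
     = (\<integral>\<^sup>+x. ennreal (gauss_pdf (c *\<^sub>R m + e) S y) * ennreal (gauss_pdf m' (v * w / S) x) \<partial>lborel)"
    by (simp add: ennreal_mult'[symmetric] gauss_pdf_nonneg)
  also have "\<dots> = ennreal (gauss_pdf (c *\<^sub>R m + e) S y)"
    using v w S by (subst nn_integral_cmult) (auto simp: nn_integral_gauss_pdf)
  finally show ?thesis by (simp add: S_def)
qed

interpretation lborel_pi: product_sigma_finite "\<lambda>_::nat. lborel :: 'a::euclidean_space measure"
  by standard

subsection \<open>Marginals of Markov chains conditioned on the initial point\<close>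

lemma measurable_coord:
  "i \<in> I \<Longrightarrow> (\<lambda>x. x i) \<in> borel_measurable (PiM I (\<lambda>_. lborel :: 'a::euclidean_space measure))"
  using measurable_component_singleton[of i I "\<lambda>_. lborel :: 'a measure"] by simp

text \<open>The density of \<open>(x 0, x j, ..., x K)\<close>: \<open>\<gamma> K\<close> is the law of the last point given \<open>x 0\<close>, and
  \<open>\<kappa> k a b\<close> is the law of \<open>x (k - 1)\<close> given \<open>x 0 = a\<close> and \<open>x k = b\<close>.\<close>

definition chain :: "('a \<Rightarrow> ennreal) \<Rightarrow> (nat \<Rightarrow> 'a \<Rightarrow> 'a \<Rightarrow> ennreal) \<Rightarrow> (nat \<Rightarrow> 'a \<Rightarrow> 'a \<Rightarrow> 'a \<Rightarrow> ennreal)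
    \<Rightarrow> nat \<Rightarrow> nat \<Rightarrow> (nat \<Rightarrow> 'a) \<Rightarrow> ennreal" where
  "chain w \<gamma> \<kappa> j K x = w (x 0) * \<gamma> K (x 0) (x K) * (\<Prod>k\<in>{Suc j..K}. \<kappa> k (x 0) (x k) (x (k - 1)))"

context
  fixes w :: "'a::euclidean_space \<Rightarrow> ennreal" and \<gamma> :: "nat \<Rightarrow> 'a \<Rightarrow> 'a \<Rightarrow> ennreal"
    and \<kappa> :: "nat \<Rightarrow> 'a \<Rightarrow> 'a \<Rightarrow> 'a \<Rightarrow> ennreal" and h :: "'a \<Rightarrow> 'a \<Rightarrow> 'a \<Rightarrow> ennreal"
  assumes meas_w [measurable]: "w \<in> borel_measurable borel"
    and meas_\<gamma>: "\<And>k. (\<lambda>(a, b). \<gamma> k a b) \<in> borel_measurable (borel \<Otimes>\<^sub>M borel)"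
    and meas_\<kappa>: "\<And>k. (\<lambda>(a, b, c). \<kappa> k a b c) \<in> borel_measurable (borel \<Otimes>\<^sub>M borel \<Otimes>\<^sub>M borel)"
    and meas_h: "(\<lambda>(a, b, c). h a b c) \<in> borel_measurable (borel \<Otimes>\<^sub>M borel \<Otimes>\<^sub>M borel)"
begin

lemma meas_comp1:
  assumes [measurable]: "f1 \<in> borel_measurable M" "f2 \<in> borel_measurable M"
  shows "(\<lambda>x. \<gamma> k (f1 x) (f2 x)) \<in> borel_measurable M"
  using measurable_compose[OF _ meas_\<gamma>, of "\<lambda>x. (f1 x, f2 x)" M k] by simp

lemma meas_comp2:
  assumes [measurable]: "f1 \<in> borel_measurable M" "f2 \<in> borel_measurable M" "f3 \<in> borel_measurable M"
  shows "(\<lambda>x. \<kappa> k (f1 x) (f2 x) (f3 x)) \<in> borel_measurable M"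
    and "(\<lambda>x. h (f1 x) (f2 x) (f3 x)) \<in> borel_measurable M"
  using measurable_compose[OF _ meas_\<kappa>, of "\<lambda>x. (f1 x, f2 x, f3 x)" M k]
    measurable_compose[OF _ meas_h, of "\<lambda>x. (f1 x, f2 x, f3 x)" M] by simp_all

lemmas meas_comp = meas_comp1 meas_comp2

lemma measurable_chain:
  assumes "{0} \<union> {j..K} \<subseteq> I" "j \<le> K"
  shows "chain w \<gamma> \<kappa> j K \<in> borel_measurable (PiM I (\<lambda>_. lborel))"
proof -
  have [measurable]: "(\<lambda>x. x k) \<in> borel_measurable (PiM I (\<lambda>_. lborel :: 'a measure))"
    if "k \<in> {0} \<union> {j..K}" for k
    using that assms by (intro measurable_coord) auto
  show ?thesis
    unfolding chain_def
    by (intro borel_measurable_times_ennreal borel_measurable_prod_ennreal meas_comp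
        measurable_compose[OF _ meas_w] measurable_coord) (use assms in \<open>auto intro!: subsetD[of "{j..K}" I]\<close>)
qed

text \<open>The top point occurs only in the terminal law and in one kernel. By \<open>conv\<close>,
  integrating it out gives the terminal law of the next lower point, so the shorter density is again
  a \<open>chain\<close>; \<open>l \<le> K\<close> keeps the test function away from the removed
  point.\<close>

lemma chain_drop_top:
  assumes conv: "\<And>a c. (\<integral>\<^sup>+b. \<gamma> (Suc K) a b * \<kappa> (Suc K) a b c \<partial>lborel) = \<gamma> K a c"
    and ij: "1 \<le> j" "j \<le> i" "i \<le> l" "l \<le> K"
  shows "(\<integral>\<^sup>+x. chain w \<gamma> \<kappa> j (Suc K) x * h (x 0) (x i) (x l) \<partial>PiM ({0} \<union> {j..Suc K}) (\<lambda>_. lborel))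
       = (\<integral>\<^sup>+x. chain w \<gamma> \<kappa> j K x * h (x 0) (x i) (x l) \<partial>PiM ({0} \<union> {j..K}) (\<lambda>_. lborel))"
proof -
  note meas_comp [measurable]
  have I: "{0} \<union> {j..Suc K} = insert (Suc K) ({0} \<union> {j..K})" using ij by auto
  have m: "(\<lambda>x. chain w \<gamma> \<kappa> j (Suc K) x * h (x 0) (x i) (x l))
      \<in> borel_measurable (PiM ({0} \<union> {j..Suc K}) (\<lambda>_. lborel))"
    using ij by (intro borel_measurable_times_ennreal measurable_chain meas_comp measurable_coord) auto
  have "(\<integral>\<^sup>+y. chain w \<gamma> \<kappa> j (Suc K) (x(Suc K := y)) * h ((x(Suc K := y)) 0) ((x(Suc K := y)) i) ((x(Suc K := y)) l) \<partial>lborel)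
      = chain w \<gamma> \<kappa> j K x * h (x 0) (x i) (x l)" for x :: "nat \<Rightarrow> 'a"
  proof -
    define P where "P = (\<Prod>k\<in>{Suc j..K}. \<kappa> k (x 0) (x k) (x (k - 1)))"
    have P: "(\<Prod>k\<in>{Suc j..K}. \<kappa> k (x 0) (if k = Suc K then y else x k) (if k - 1 = Suc K then y else x (k - 1))) = P" for y
      unfolding P_def by (intro prod.cong refl) auto
    have "(\<integral>\<^sup>+y. chain w \<gamma> \<kappa> j (Suc K) (x(Suc K := y)) * h ((x(Suc K := y)) 0) ((x(Suc K := y)) i) ((x(Suc K := y)) l) \<partial>lborel)
       = (\<integral>\<^sup>+y. (w (x 0) * P * h (x 0) (x i) (x l)) * (\<gamma> (Suc K) (x 0) y * \<kappa> (Suc K) (x 0) y (x K)) \<partial>lborel)"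
      using ij P
      by (intro nn_integral_cong) (simp add: chain_def prod.nat_ivl_Suc' mult_ac fun_upd_def)
    also have "\<dots> = (w (x 0) * P * h (x 0) (x i) (x l)) * \<gamma> K (x 0) (x K)"
      by (subst nn_integral_cmult) (auto simp: conv)
    finally show ?thesis by (simp add: chain_def P_def mult_ac)
  qed
  then show ?thesis
    unfolding I using ij m[unfolded I]
    by (subst lborel_pi.product_nn_integral_insert) auto
qed

text \<open>The lowest point above 0 is the third argument of one kernel and occurs nowhere else, so
  that kernel integrates to 1.\<close>

lemma chain_drop_bottom:
  assumes mass: "\<And>a b. (\<integral>\<^sup>+c. \<kappa> (Suc j) a b c \<partial>lborel) = 1"
    and ij: "1 \<le> j" "Suc j \<le> i" "i \<le> l" "l \<le> K"
  shows "(\<integral>\<^sup>+x. chain w \<gamma> \<kappa> j K x * h (x 0) (x i) (x l) \<partial>PiM ({0} \<union> {j..K}) (\<lambda>_. lborel))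
       = (\<integral>\<^sup>+x. chain w \<gamma> \<kappa> (Suc j) K x * h (x 0) (x i) (x l) \<partial>PiM ({0} \<union> {Suc j..K}) (\<lambda>_. lborel))"
proof -
  note meas_comp [measurable]
  have I: "{0} \<union> {j..K} = insert j ({0} \<union> {Suc j..K})" using ij by auto
  have m: "(\<lambda>x. chain w \<gamma> \<kappa> j K x * h (x 0) (x i) (x l))
      \<in> borel_measurable (PiM ({0} \<union> {j..K}) (\<lambda>_. lborel))"
    using ij by (intro borel_measurable_times_ennreal measurable_chain meas_comp measurable_coord) auto
  have "(\<integral>\<^sup>+y. chain w \<gamma> \<kappa> j K (x(j := y)) * h ((x(j := y)) 0) ((x(j := y)) i) ((x(j := y)) l) \<partial>lborel)
      = chain w \<gamma> \<kappa> (Suc j) K x * h (x 0) (x i) (x l)" for x :: "nat \<Rightarrow> 'a"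
  proof -
    define P where "P = (\<Prod>k\<in>{Suc (Suc j)..K}. \<kappa> k (x 0) (x k) (x (k - 1)))"
    have P: "(\<Prod>k\<in>{Suc (Suc j)..K}. \<kappa> k (x 0) (if k = j then y else x k) (if k - 1 = j then y else x (k - 1))) = P" for y
      unfolding P_def by (intro prod.cong refl) auto
    have "(\<integral>\<^sup>+y. chain w \<gamma> \<kappa> j K (x(j := y)) * h ((x(j := y)) 0) ((x(j := y)) i) ((x(j := y)) l) \<partial>lborel)
       = (\<integral>\<^sup>+y. (w (x 0) * \<gamma> K (x 0) (x K) * P * h (x 0) (x i) (x l)) * \<kappa> (Suc j) (x 0) (x (Suc j)) y \<partial>lborel)"
      using ij P
      by (intro nn_integral_cong) (simp add: chain_def prod.atLeast_Suc_atMost[of "Suc j" K] mult_ac fun_upd_def)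
    also have "\<dots> = w (x 0) * \<gamma> K (x 0) (x K) * P * h (x 0) (x i) (x l)"
      by (subst nn_integral_cmult) (auto simp: mass)
    finally show ?thesis by (simp add: chain_def P_def mult_ac)
  qed
  then show ?thesis
    unfolding I using ij m[unfolded I]
    by (subst lborel_pi.product_nn_integral_insert) auto
qed

context
  fixes K :: nat
  assumes conv: "\<And>k a c. 2 \<le> k \<Longrightarrow> k \<le> K \<Longrightarrow> (\<integral>\<^sup>+b. \<gamma> k a b * \<kappa> k a b c \<partial>lborel) = \<gamma> (k - 1) a c"
    and mass: "\<And>k a b. 2 \<le> k \<Longrightarrow> k \<le> K \<Longrightarrow> (\<integral>\<^sup>+c. \<kappa> k a b c \<partial>lborel) = 1"
begin

text \<open>Points above \<open>l\<close> are peeled off from the top and then points below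
  \<open>i\<close> from the bottom. Point 0 always stays, since every factor depends on it.\<close>

lemma chain_reduce:
  assumes il: "1 \<le> i" "i \<le> l" "l \<le> K"
  shows "(\<integral>\<^sup>+x. chain w \<gamma> \<kappa> 1 K x * h (x 0) (x i) (x l) \<partial>PiM {0..K} (\<lambda>_. lborel))
       = (\<integral>\<^sup>+x. chain w \<gamma> \<kappa> i l x * h (x 0) (x i) (x l) \<partial>PiM (insert 0 {i..l}) (\<lambda>_. lborel))"
proof -
  let ?E = "\<lambda>j m. \<integral>\<^sup>+x. chain w \<gamma> \<kappa> j m x * h (x 0) (x i) (x l) \<partial>PiM ({0} \<union> {j..m}) (\<lambda>_. lborel)"
  have top: "?E 1 m = ?E 1 l" if "l \<le> m" "m \<le> K" for m
    using that
  proof (induction m rule: dec_induct)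
    case (step m)
    have "?E 1 (Suc m) = ?E 1 m"
      using step.hyps step.prems il conv[of "Suc m"] by (intro chain_drop_top) auto
    with step show ?case by simp
  qed simp
  have bot: "?E 1 l = ?E j l" if "1 \<le> j" "j \<le> i" for j
    using that
  proof (induction j rule: dec_induct)
    case (step j)
    have "?E j l = ?E (Suc j) l"
      using step.hyps step.prems il mass[of "Suc j"] by (intro chain_drop_bottom) auto
    with step show ?case by simp
  qed simp
  have "{0..K} = {0} \<union> {1..K}" by auto
  with top[of K] bot[of i] il show ?thesis by simp
qed

text \<open>The case \<open>i = l\<close>, in which no kernel survives the reduction.\<close>

lemma chain_pair:
  assumes l: "1 \<le> l" "l \<le> K"
  shows "(\<integral>\<^sup>+x. chain w \<gamma> \<kappa> 1 K x * h (x 0) (x l) (x l) \<partial>PiM {0..K} (\<lambda>_. lborel))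
       = (\<integral>\<^sup>+a. \<integral>\<^sup>+b. w a * \<gamma> l a b * h a b b \<partial>lborel \<partial>lborel)"
proof -
  note meas_comp [measurable]
  have m: "(\<lambda>x. w (x 0) * \<gamma> l (x 0) (x l) * h (x 0) (x l) (x l))
      \<in> borel_measurable (PiM (insert l {0}) (\<lambda>_. lborel))"
    by (intro borel_measurable_times_ennreal meas_comp measurable_compose[OF _ meas_w] measurable_coord) auto
  have s: "insert 0 {l..l} = insert l {0}" by auto
  have "(\<integral>\<^sup>+x. chain w \<gamma> \<kappa> 1 K x * h (x 0) (x l) (x l) \<partial>PiM {0..K} (\<lambda>_. lborel))
      = (\<integral>\<^sup>+x. w (x 0) * \<gamma> l (x 0) (x l) * h (x 0) (x l) (x l) \<partial>PiM (insert l {0}) (\<lambda>_. lborel))"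
    using chain_reduce[of l l] l unfolding s by (simp add: chain_def)
  also have "\<dots> = (\<integral>\<^sup>+x. (\<integral>\<^sup>+b. w (x 0) * \<gamma> l (x 0) b * h (x 0) b b \<partial>lborel) \<partial>PiM {0::nat} (\<lambda>_. lborel))"
    using l m by (subst lborel_pi.product_nn_integral_insert) auto
  also have "\<dots> = (\<integral>\<^sup>+a. \<integral>\<^sup>+b. w a * \<gamma> l a b * h a b b \<partial>lborel \<partial>lborel)"
    by (rule lborel_pi.product_nn_integral_singleton) simp
  finally show ?thesis .
qed

text \<open>The case of two adjacent points: exactly one kernel survives. Its integral is put
  innermost so that it can be evaluated for fixed \<open>x 0\<close> and \<open>x k\<close>.\<close>

lemma chain_triple:
  assumes k: "2 \<le> k" "k \<le> K"
  shows "(\<integral>\<^sup>+x. chain w \<gamma> \<kappa> 1 K x * h (x 0) (x (k - 1)) (x k) \<partial>PiM {0..K} (\<lambda>_. lborel))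
       = (\<integral>\<^sup>+a. \<integral>\<^sup>+b. w a * \<gamma> k a b * (\<integral>\<^sup>+c. \<kappa> k a b c * h a c b \<partial>lborel) \<partial>lborel \<partial>lborel)"
proof -
  note meas_comp [measurable]
  have s: "insert 0 {k - 1..k} = insert (k - 1) (insert k {0})" using k by auto
  have ne: "k \<noteq> k - Suc 0" using k by auto
  have s': "{Suc (k - 1)..k} = {k}" using k by auto
  let ?f = "\<lambda>x. w (x 0) * \<gamma> k (x 0) (x k) * (\<kappa> k (x 0) (x k) (x (k - 1)) * h (x 0) (x (k - 1)) (x k))"
  let ?g = "\<lambda>x. w (x 0) * \<gamma> k (x 0) (x k) * (\<integral>\<^sup>+c. \<kappa> k (x 0) (x k) c * h (x 0) c (x k) \<partial>lborel)"
  have m: "?f \<in> borel_measurable (PiM (insert (k - 1) (insert k {0})) (\<lambda>_. lborel))"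
    by (intro borel_measurable_times_ennreal meas_comp measurable_compose[OF _ meas_w] measurable_coord) auto
  have [measurable]: "(\<lambda>x. x 0) \<in> borel_measurable (PiM (insert k {0}) (\<lambda>_. lborel :: 'a measure))"
    "(\<lambda>x. x k) \<in> borel_measurable (PiM (insert k {0}) (\<lambda>_. lborel :: 'a measure))"
    by (auto intro: measurable_coord)
  have m': "?g \<in> borel_measurable (PiM (insert k {0}) (\<lambda>_. lborel))"
    by measurable
  have "(\<integral>\<^sup>+x. chain w \<gamma> \<kappa> 1 K x * h (x 0) (x (k - 1)) (x k) \<partial>PiM {0..K} (\<lambda>_. lborel))
      = integral\<^sup>N (PiM (insert (k - 1) (insert k {0})) (\<lambda>_. lborel)) ?f"
    using chain_reduce[of "k - 1" k] k unfolding s by (simp add: chain_def s' mult.assoc)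
  also have "\<dots> = integral\<^sup>N (PiM (insert k {0}) (\<lambda>_. lborel)) ?g"
    using k m
    by (subst lborel_pi.product_nn_integral_insert) (auto simp: nn_integral_cmult ne)
  also have "\<dots> = (\<integral>\<^sup>+x. (\<integral>\<^sup>+b. ?g (x(k := b)) \<partial>lborel) \<partial>PiM {0::nat} (\<lambda>_. lborel))"
    using k m' by (subst lborel_pi.product_nn_integral_insert) auto
  also have "\<dots> = (\<integral>\<^sup>+x. (\<integral>\<^sup>+b. w (x 0) * \<gamma> k (x 0) b * (\<integral>\<^sup>+c. \<kappa> k (x 0) b c * h (x 0) c b \<partial>lborel) \<partial>lborel) \<partial>PiM {0::nat} (\<lambda>_. lborel))"
    using k by simp
  also have "\<dots> = (\<integral>\<^sup>+a. \<integral>\<^sup>+b. w a * \<gamma> k a b * (\<integral>\<^sup>+c. \<kappa> k a b c * h a c b \<partial>lborel) \<partial>lborel \<partial>lborel)"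
    by (rule lborel_pi.product_nn_integral_singleton) simp
  finally show ?thesis .
qed

end

end

subsection \<open>A Taylor bound and the Kullback-Leibler divergence\<close>

lemma exp_neg_mult_le: "z * exp (- z) \<le> (1::real)"
proof -
  have "z \<le> exp z" using exp_ge_add_one_self[of z] by linarith
  then show ?thesis by (simp add: exp_minus field_simps)
qed

text \<open>The remainder is quadratic in \<open>h\<close> uniformly in \<open>u\<close>. This
  uniformity is what later permits differentiation under an integral over \<open>u\<close>.\<close>

lemma gauss_taylor_bound:
  fixes u h :: "'a::real_inner"
  assumes b: "0 < b"
  shows "\<bar>exp (- (norm (u + h))\<^sup>2 / (2 * b)) - exp (- (norm u)\<^sup>2 / (2 * b)) * (1 - (u \<bullet> h) / b)\<bar>
       \<le> 3 / (2 * b) * (norm h)\<^sup>2"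
proof -
  \<comment> \<open>The Gaussian restricted to the segment from \<open>u\<close> to
    \<open>u + h\<close>; \<open>f1\<close> and \<open>f2\<close> are its first two
    derivatives.\<close>
  define f where "f s = exp (- (u \<bullet> u + 2 * s * (u \<bullet> h) + s\<^sup>2 * (h \<bullet> h)) / (2 * b))" for s :: real
  define f1 where "f1 s = - (u \<bullet> h + s * (h \<bullet> h)) / b * f s" for s
  define f2 where "f2 s = ((u \<bullet> h + s * (h \<bullet> h))\<^sup>2 / b\<^sup>2 - (h \<bullet> h) / b) * f s" for s
  define D where "D m = (if m = 0 then f else if m = (1::nat) then f1 else f2)" for m
  have fe: "f s = exp (- (norm (u + s *\<^sub>R h))\<^sup>2 / (2 * b))" for s
    unfolding f_def power2_norm_eq_inner
    by (simp add: inner_add_left inner_add_right inner_commute power2_eq_square algebra_simps)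
  have d1: "(f has_real_derivative f1 s) (at s)" for s
    unfolding f_def f1_def using b
    by (auto intro!: derivative_eq_intros simp: field_simps)
  have d2: "(f1 has_real_derivative f2 s) (at s)" for s
    unfolding f1_def f2_def using b
    by (auto intro!: derivative_eq_intros d1 simp: f1_def field_simps power2_eq_square)
  have "\<forall>m t. m < 2 \<and> 0 \<le> t \<and> t \<le> 1 \<longrightarrow> DERIV (D m) t :> D (Suc m) t"
    using d1 d2 by (auto simp: D_def less_2_cases_iff)
  from Maclaurin[of 1 2 D f, OF _ _ _ this] obtain t where
    t: "f 1 = (\<Sum>m<2. D m 0 / fact m * 1 ^ m) + D 2 t / fact 2 * 1 ^ 2"
    by (auto simp: D_def)
  then have e: "f 1 - (f 0 + f1 0) = f2 t / 2"
    by (simp add: D_def numeral_2_eq_2)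
  \<comment> \<open>The term with \<open>(W \<bullet> h)\<^sup>2\<close> costs \<open>2 / b\<close>,
    by Cauchy-Schwarz and \<open>exp_neg_mult_le\<close> at
    \<open>(norm W)\<^sup>2 / (2 * b)\<close>; the term with \<open>h \<bullet> h\<close> costs
    \<open>1 / b\<close>. The factorial then halves \<open>3 / b\<close>.\<close>
  have f2: "\<bar>f2 t\<bar> \<le> 3 / b * (norm h)\<^sup>2"
  proof -
    define W where "W = u + t *\<^sub>R h"
    have W: "u \<bullet> h + t * (h \<bullet> h) = W \<bullet> h" by (simp add: W_def inner_add_left)
    have "(W \<bullet> h)\<^sup>2 \<le> (norm W)\<^sup>2 * (norm h)\<^sup>2"
      using Cauchy_Schwarz_ineq[of W h] by (simp add: power2_norm_eq_inner)
    then have "(W \<bullet> h)\<^sup>2 / b\<^sup>2 * f t \<le> (norm W)\<^sup>2 * (norm h)\<^sup>2 / b\<^sup>2 * f t"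
      by (intro mult_right_mono divide_right_mono) (auto simp: f_def)
    also have "\<dots> = 2 / b * (norm h)\<^sup>2 * (((norm W)\<^sup>2 / (2 * b)) * exp (- ((norm W)\<^sup>2 / (2 * b))))"
      using b by (simp add: fe W_def power2_eq_square)
    also have "\<dots> \<le> 2 / b * (norm h)\<^sup>2 * 1"
      using b by (intro mult_left_mono exp_neg_mult_le) auto
    finally have 1: "(W \<bullet> h)\<^sup>2 / b\<^sup>2 * f t \<le> 2 / b * (norm h)\<^sup>2" by simp
    have "(h \<bullet> h) / b * f t \<le> (h \<bullet> h) / b * 1"
      using b by (intro mult_left_mono) (auto simp: fe)
    then have 2: "(h \<bullet> h) / b * f t \<le> 1 / b * (norm h)\<^sup>2" by (simp add: power2_norm_eq_inner)
    have "0 \<le> (W \<bullet> h)\<^sup>2 / b\<^sup>2 * f t" "0 \<le> (h \<bullet> h) / b * f t"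
      using b by (auto simp: f_def)
    with 1 2 show ?thesis
      unfolding f2_def W left_diff_distrib by (simp add: abs_le_iff)
  qed
  have "f 1 = exp (- (norm (u + h))\<^sup>2 / (2 * b))" "f 0 = exp (- (norm u)\<^sup>2 / (2 * b))"
    "f1 0 = - (u \<bullet> h) / b * f 0"
    by (auto simp: fe f1_def)
  then have "exp (- (norm (u + h))\<^sup>2 / (2 * b)) - exp (- (norm u)\<^sup>2 / (2 * b)) * (1 - (u \<bullet> h) / b)
      = f2 t / 2"
    using e by (simp add: algebra_simps)
  moreover have "\<bar>f2 t / 2\<bar> \<le> 3 / (2 * b) * (norm h)\<^sup>2"
    using f2 by simp
  ultimately show ?thesis by (simp only:)
qed

text \<open>Bias-variance decomposition for an unnormalised weight: around the weighted mean
  \<open>m\<close> the cross term vanishes.\<close>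

lemma nn_integral_weighted_sq:
  fixes w :: "'a::euclidean_space \<Rightarrow> real"
  assumes w0: "\<And>x. 0 \<le> w x" and w: "integrable lborel w"
    and wx: "integrable lborel (\<lambda>x. w x *\<^sub>R x)" and wxx: "integrable lborel (\<lambda>x. w x * (norm x)\<^sup>2)"
    and Z: "0 < integral\<^sup>L lborel w"
  defines "m \<equiv> (1 / integral\<^sup>L lborel w) *\<^sub>R (\<integral>x. w x *\<^sub>R x \<partial>lborel)"
  shows "(\<integral>\<^sup>+x. ennreal (w x * (norm (\<beta> *\<^sub>R x - \<nu>))\<^sup>2) \<partial>lborel)
    = ennreal (integral\<^sup>L lborel w * (norm (\<beta> *\<^sub>R m - \<nu>))\<^sup>2)
      + ennreal (\<beta>\<^sup>2) * ennreal (\<integral>x. w x * (norm (x - m))\<^sup>2 \<partial>lborel)"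
proof -
  let ?Z = "integral\<^sup>L lborel w" and ?X = "\<integral>x. w x *\<^sub>R x \<partial>lborel"
  let ?Q = "\<integral>x. w x * (norm x)\<^sup>2 \<partial>lborel"
  have eq: "w x * (norm (\<beta> *\<^sub>R x - \<nu>))\<^sup>2
      = \<beta>\<^sup>2 * (w x * (norm x)\<^sup>2) - (w x *\<^sub>R x) \<bullet> ((2 * \<beta>) *\<^sub>R \<nu>) + w x * (norm \<nu>)\<^sup>2" for \<beta> \<nu> x
    unfolding power2_norm_eq_inner
    by (simp add: inner_diff_left inner_diff_right inner_commute power2_eq_square algebra_simps)
  have int: "integrable lborel (\<lambda>x. w x * (norm (\<beta> *\<^sub>R x - \<nu>))\<^sup>2)"
    and val: "(\<integral>x. w x * (norm (\<beta> *\<^sub>R x - \<nu>))\<^sup>2 \<partial>lborel)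
       = \<beta>\<^sup>2 * ?Q - ?X \<bullet> ((2 * \<beta>) *\<^sub>R \<nu>) + ?Z * (norm \<nu>)\<^sup>2" for \<beta> \<nu>
    unfolding eq using w wx wxx by (simp_all del: inner_scaleR_left inner_scaleR_right)
  have X: "?X = ?Z *\<^sub>R m" using Z by (simp add: m_def)
  have "(\<integral>x. w x * (norm (\<beta> *\<^sub>R x - \<nu>))\<^sup>2 \<partial>lborel)
     = ?Z * (norm (\<beta> *\<^sub>R m - \<nu>))\<^sup>2 + \<beta>\<^sup>2 * (\<integral>x. w x * (norm (1 *\<^sub>R x - m))\<^sup>2 \<partial>lborel)"
    unfolding val X unfolding power2_norm_eq_inner
    by (simp add: inner_diff_left inner_diff_right inner_commute power2_eq_square algebra_simps)
  then show ?thesis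
    using w0 Z int[of \<beta> \<nu>]
    by (subst nn_integral_eq_integral) (auto simp: ennreal_mult' ennreal_plus)
qed

text \<open>\<open>r + q = r + q\<close> written through positive and negative parts and without
  subtraction, so that it can be integrated even when \<open>q\<close> has infinite
  integral.\<close>

lemma ennreal_pos_neg_balance:
  assumes "0 \<le> q"
  shows "ennreal (r + q) + ennreal (- r) = ennreal (- (r + q)) + ennreal r + ennreal q"
proof -
  have m: "ennreal x = ennreal (max 0 x)" for x by (simp add: ennreal_max_0')
  have "ennreal (max 0 (r + q)) + ennreal (max 0 (- r)) = ennreal (max 0 (r + q) + max 0 (- r))"
    by (rule ennreal_plus[symmetric]) auto
  also have "max 0 (r + q) + max 0 (- r) = max 0 (- (r + q)) + max 0 r + q"
    using assms by (auto simp: max_def)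
  also have "ennreal \<dots> = ennreal (max 0 (- (r + q))) + ennreal (max 0 r) + ennreal q"
    using assms by (subst ennreal_plus, simp_all)+
  finally show ?thesis
    by (simp only: m[symmetric])
qed

text \<open>Since \<open>Q\<close> is nonnegative, the negative part of \<open>R + Q\<close> is at
  most that of \<open>R\<close>, hence has finite integral, and the difference in
  \<open>KL_div\<close> is never of the form infinity minus infinity. The hypothesis on the
  logarithm is taken almost everywhere in \<open>P\<close> because it says nothing useful where
  \<open>f\<close> vanishes.\<close>

lemma KL_div_density:
  fixes f g R Q :: "'a \<Rightarrow> real" and M :: "'a measure"
  defines "P \<equiv> density M (\<lambda>x. ennreal (f x))"
  assumes [measurable]: "f \<in> borel_measurable M" "g \<in> borel_measurable M" "Q \<in> borel_measurable M"
    and f: "\<And>x. 0 \<le> f x" and g: "\<And>x. 0 < g x"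
    and R: "integrable P R" and Q: "\<And>x. 0 \<le> Q x"
    and eq: "AE x in P. ln (f x / g x) = R x + Q x"
  shows "KL_div M f g = ereal (integral\<^sup>L P R) + enn2ereal (\<integral>\<^sup>+x. ennreal (Q x) \<partial>P)"
proof -
  have [measurable]: "R \<in> borel_measurable M" "Q \<in> borel_measurable P" "R \<in> borel_measurable P"
    using borel_measurable_integrable[OF R] by (auto simp: P_def)
  define Hp where "Hp = (\<integral>\<^sup>+x. ennreal (R x + Q x) \<partial>P)"
  define Hm where "Hm = (\<integral>\<^sup>+x. ennreal (- (R x + Q x)) \<partial>P)"
  define Rp where "Rp = (\<integral>\<^sup>+x. ennreal (R x) \<partial>P)"
  define Rm where "Rm = (\<integral>\<^sup>+x. ennreal (- R x) \<partial>P)"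
  define I where "I = (\<integral>\<^sup>+x. ennreal (Q x) \<partial>P)"
  have den: "(\<integral>\<^sup>+x. ennreal (f x * u x) \<partial>M) = (\<integral>\<^sup>+x. ennreal (u x) \<partial>P)"
    if [measurable]: "u \<in> borel_measurable M" for u
    unfolding P_def using f by (subst nn_integral_density) (auto simp: ennreal_mult')
  have "(\<integral>\<^sup>+x. ennreal (f x * ln (f x / g x)) \<partial>M) = Hp"
    unfolding Hp_def by (subst den) (use eq in \<open>auto intro!: nn_integral_cong_AE\<close>)
  moreover have "(\<integral>\<^sup>+x. ennreal (- (f x * ln (f x / g x))) \<partial>M) = Hm"
    unfolding Hm_def mult_minus_right[symmetric]
    by (subst den) (use eq in \<open>auto intro!: nn_integral_cong_AE\<close>)
  ultimately have KL: "KL_div M f g = enn2ereal Hp - enn2ereal Hm"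
    using g by (simp add: KL_div_def)
  have "(\<integral>\<^sup>+x. ennreal (R x + Q x) + ennreal (- R x) \<partial>P)
      = (\<integral>\<^sup>+x. ennreal (- (R x + Q x)) + ennreal (R x) + ennreal (Q x) \<partial>P)"
    using Q by (intro nn_integral_cong ennreal_pos_neg_balance) auto
  then have bal: "Hp + Rm = Hm + Rp + I"
    unfolding Hp_def Hm_def Rp_def Rm_def I_def
    by (simp add: nn_integral_add del: minus_add_distrib)
  have "Hm \<le> Rm"
    unfolding Hm_def Rm_def by (intro nn_integral_mono ennreal_leI) (use Q in auto)
  moreover have "Rp < \<infinity>" "Rm < \<infinity>"
    using R unfolding real_integrable_def Rp_def Rm_def by (auto simp: less_top)
  ultimately obtain hm rp rm where r: "Hm = ennreal hm" "Rp = ennreal rp" "Rm = ennreal rm"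
    and nn: "0 \<le> hm" "0 \<le> rp" "0 \<le> rm"
    by (metis ennreal_cases infinity_ennreal_def le_less_trans less_irrefl)
  have iR: "integral\<^sup>L P R = rp - rm"
    using real_lebesgue_integral_def[OF R] r nn by (simp add: Rp_def Rm_def)
  show ?thesis
  proof (cases I)
    case (real i)
    with bal r nn have "Hp \<noteq> top"
      by (metis ennreal_plus ennreal_neq_top add_nonneg_nonneg ennreal_add_eq_top)
    then obtain hp where hp: "Hp = ennreal hp" "0 \<le> hp" by (cases Hp) auto
    with bal r nn real have "hp + rm = hm + rp + i"
      by (simp add: ennreal_plus[symmetric] del: ennreal_plus)
    then show ?thesis
      using KL hp r nn real iR by (simp add: I_def[symmetric])
  next
    case top
    with bal r nn have "Hp = top" by (cases Hp) (auto simp: ennreal_plus[symmetric] simp del: ennreal_plus)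
    then show ?thesis
      using KL top r nn by (simp add: I_def[symmetric])
  qed
qed

lemma ln_plus_ratio_ge:
  fixes s v :: real
  assumes "0 < s" "0 < v"
  shows "ln v + 1 \<le> ln s + v / s"
  using ln_le_minus_one[of "v / s"] assms by (simp add: ln_div)

subsection \<open>Posterior mean and Tweedie's formula\<close>

locale data_density =
  fixes q0 :: "real^'d \<Rightarrow> real"
  assumes q0_meas [measurable]: "q0 \<in> borel_measurable borel"
    and q0_nonneg: "\<And>x. 0 \<le> q0 x"
    and q0_mass: "(\<integral>\<^sup>+x. ennreal (q0 x) \<partial>lborel) = 1"
    and q0_second: "(\<integral>\<^sup>+x. ennreal (q0 x * (norm x)\<^sup>2) \<partial>lborel) < \<infinity>"
begin

lemma q0_integrable: "integrable lborel q0" and q0_integral: "integral\<^sup>L lborel q0 = 1"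
  using nn_integral_eq_integrable[of q0 lborel 1] q0_nonneg q0_mass by auto

lemma q0_sq_integrable: "integrable lborel (\<lambda>x. q0 x * (norm x)\<^sup>2)"
  using q0_second q0_nonneg by (intro integrableI_nonneg) auto

text \<open>Joint density of a data point \<open>x\<close> and an observation \<open>y\<close> of
  \<open>a *\<^sub>R x\<close> in Gaussian noise of variance \<open>b\<close>. For fixed
  \<open>y\<close> it is the unnormalised posterior of \<open>x\<close>, with normalising factor
  \<open>evid\<close>.\<close>

definition wt :: "real \<Rightarrow> real \<Rightarrow> real^'d \<Rightarrow> real^'d \<Rightarrow> real" where
  "wt a b y x = q0 x * gauss_pdf (a *\<^sub>R x) b y"

definition evid :: "real \<Rightarrow> real \<Rightarrow> real^'d \<Rightarrow> real" where
  "evid a b y = (\<integral>x. wt a b y x \<partial>lborel)"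

definition pmean :: "real \<Rightarrow> real \<Rightarrow> real^'d \<Rightarrow> real^'d" where
  "pmean a b y = (1 / evid a b y) *\<^sub>R (\<integral>x. wt a b y x *\<^sub>R x \<partial>lborel)"

text \<open>The trace of the posterior covariance multiplied by \<open>evid\<close>, so that its
  plain Lebesgue integral is the minimal mean squared error of estimating \<open>x\<close> from
  \<open>y\<close>.\<close>

definition pvar :: "real \<Rightarrow> real \<Rightarrow> real^'d \<Rightarrow> real" where
  "pvar a b y = (\<integral>x. wt a b y x * (norm (x - pmean a b y))\<^sup>2 \<partial>lborel)"

definition mmse :: "real \<Rightarrow> real \<Rightarrow> real" where
  "mmse a b = enn2real (\<integral>\<^sup>+y. ennreal (pvar a b y) \<partial>lborel)"

lemma wt_meas [measurable]:
  assumes [measurable]: "f \<in> borel_measurable M" "g \<in> borel_measurable M"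
  shows "(\<lambda>z. wt a b (f z) (g z)) \<in> borel_measurable M"
  unfolding wt_def by measurable

lemma evid_meas [measurable]: "evid a b \<in> borel_measurable borel"
  unfolding evid_def by measurable

lemma pmean_meas [measurable]: "pmean a b \<in> borel_measurable borel"
  unfolding pmean_def by measurable

lemma pvar_meas [measurable]: "pvar a b \<in> borel_measurable borel"
  unfolding pvar_def by measurable

lemma wt_nonneg: "0 \<le> wt a b y x"
  by (simp add: wt_def q0_nonneg gauss_pdf_nonneg)

context
  fixes a b :: real
  assumes b: "0 < b"
begin

text \<open>The kernel is at most its peak value; this transfers integrability from
  \<open>q0\<close> to the posterior weights at every \<open>y\<close>.\<close>

lemma wt_le: "wt a b y x \<le> (2 * pi * b) powr (- real CARD('d) / 2) * q0 x"
  using q0_nonneg[of x] b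
  by (simp add: wt_def gauss_pdf_def mult.commute mult_left_le mult_le_one mult_left_mono)

lemma wt_integrable: "integrable lborel (wt a b y)"
  and wt_sq_integrable: "integrable lborel (\<lambda>x. wt a b y x * (norm x)\<^sup>2)"
  and wt_id_integrable: "integrable lborel (\<lambda>x. wt a b y x *\<^sub>R x)"
proof -
  let ?c = "(2 * pi * b) powr (- real CARD('d) / 2)"
  show 1: "integrable lborel (wt a b y)"
    by (rule Bochner_Integration.integrable_bound[of lborel "\<lambda>x. ?c * q0 x"])
      (use wt_le wt_nonneg q0_integrable q0_nonneg in \<open>auto\<close>)
  have le: "wt a b y x * (norm x)\<^sup>2 \<le> ?c * (q0 x * (norm x)\<^sup>2)" for x
    using mult_right_mono[OF wt_le, of "(norm x)\<^sup>2" y x] by (simp add: mult_ac)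
  show 2: "integrable lborel (\<lambda>x. wt a b y x * (norm x)\<^sup>2)"
    by (rule Bochner_Integration.integrable_bound[of lborel "\<lambda>x. ?c * (q0 x * (norm x)\<^sup>2)"])
      (use le wt_nonneg q0_sq_integrable q0_nonneg in \<open>auto\<close>)
  have le': "norm x \<le> 1 + (norm x)\<^sup>2" for x :: "real^'d"
    using zero_le_power2[of "norm x - 1"] unfolding power2_diff by (auto simp: algebra_simps) (smt (verit) norm_ge_zero)
  have "wt a b y x * norm x \<le> wt a b y x + wt a b y x * (norm x)\<^sup>2" for x
    using mult_left_mono[OF le'[of x] wt_nonneg[of a b y x]] by (simp add: algebra_simps)
  then show "integrable lborel (\<lambda>x. wt a b y x *\<^sub>R x)"
    by (intro Bochner_Integration.integrable_bound[OF Bochner_Integration.integrable_add[OF 1 2]])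
      (use wt_nonneg in \<open>auto simp: add_nonneg_nonneg\<close>)
qed

lemma q0_not_AE_0: "\<not> (AE x in lborel. q0 x = 0)"
proof
  assume "AE x in lborel. q0 x = 0"
  then have "(\<integral>\<^sup>+x. ennreal (q0 x) \<partial>lborel) = (\<integral>\<^sup>+x. 0 \<partial>(lborel :: (real^'d) measure))"
    by (intro nn_integral_cong_AE) auto
  with q0_mass show False by simp
qed

lemma evid_pos: "0 < evid a b y"
proof -
  have "evid a b y \<noteq> 0"
    unfolding evid_def
    using q0_not_AE_0 gauss_pdf_pos[OF b, of "a *\<^sub>R _" y] wt_nonneg wt_integrable
    by (subst integral_nonneg_eq_0_iff_AE) (auto simp: wt_def less_imp_neq[symmetric])
  moreover have "0 \<le> evid a b y" unfolding evid_def by (simp add: wt_nonneg)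
  ultimately show ?thesis by simp
qed

lemma wt_pvar_integrable: "integrable lborel (\<lambda>x. wt a b y x * (norm (x - m))\<^sup>2)"
proof -
  have eq: "wt a b y x * (norm (x - m))\<^sup>2
      = (wt a b y x * (norm x)\<^sup>2) - (wt a b y x *\<^sub>R x) \<bullet> (2 *\<^sub>R m) + wt a b y x * (norm m)\<^sup>2" for x
    unfolding power2_norm_eq_inner
    by (simp add: inner_diff_left inner_diff_right inner_commute power2_eq_square algebra_simps)
  show ?thesis
    unfolding eq using wt_integrable wt_sq_integrable wt_id_integrable
    by (simp del: inner_scaleR_left inner_scaleR_right)
qed

text \<open>Zero posterior variance would concentrate \<open>q0\<close> at one point, which is
  impossible for a density because points are Lebesgue null sets.\<close>

lemma pvar_pos: "0 < pvar a b y"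
proof -
  have "pvar a b y \<noteq> 0"
  proof
    assume "pvar a b y = 0"
    then have "AE x in lborel. wt a b y x * (norm (x - pmean a b y))\<^sup>2 = 0"
      unfolding pvar_def
      by (subst (asm) integral_nonneg_eq_0_iff_AE) (auto simp: wt_nonneg wt_pvar_integrable)
    then have "AE x in lborel. q0 x = 0"
      using AE_lborel_singleton[of "pmean a b y"]
      by eventually_elim (use gauss_pdf_pos[OF b, of "a *\<^sub>R _" y] in \<open>auto simp: wt_def less_imp_neq[symmetric]\<close>)
    then show False using q0_not_AE_0 by simp
  qed
  moreover have "0 \<le> pvar a b y" unfolding pvar_def by (simp add: wt_nonneg)
  ultimately show ?thesis by simp
qed

text \<open>After exchanging the integrals, the decomposition around the posterior mean applies for
  each fixed \<open>y\<close>. The first summand is the only one that depends on the estimator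
  \<open>\<nu>\<close>, and it vanishes when \<open>\<nu>\<close> is \<open>\<beta>\<close> times
  the posterior mean.\<close>

lemma nn_integral_wt_sq:
  assumes [measurable]: "\<nu> \<in> borel_measurable borel"
  shows "(\<integral>\<^sup>+x. \<integral>\<^sup>+y. ennreal (wt a b y x * (norm (\<beta> *\<^sub>R x - \<nu> y))\<^sup>2) \<partial>lborel \<partial>lborel)
    = (\<integral>\<^sup>+y. ennreal (evid a b y * (norm (\<beta> *\<^sub>R pmean a b y - \<nu> y))\<^sup>2) \<partial>lborel)
      + ennreal (\<beta>\<^sup>2) * (\<integral>\<^sup>+y. ennreal (pvar a b y) \<partial>lborel)"
proof -
  have "(\<integral>\<^sup>+x. \<integral>\<^sup>+y. ennreal (wt a b y x * (norm (\<beta> *\<^sub>R x - \<nu> y))\<^sup>2) \<partial>lborel \<partial>lborel)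
      = (\<integral>\<^sup>+y. \<integral>\<^sup>+x. ennreal (wt a b y x * (norm (\<beta> *\<^sub>R x - \<nu> y))\<^sup>2) \<partial>lborel \<partial>lborel)"
    by (intro lborel_pair.Fubini') measurable
  also have "\<dots> = (\<integral>\<^sup>+y. ennreal (evid a b y * (norm (\<beta> *\<^sub>R pmean a b y - \<nu> y))\<^sup>2)
      + ennreal (\<beta>\<^sup>2) * ennreal (pvar a b y) \<partial>lborel)"
    using nn_integral_weighted_sq[OF wt_nonneg wt_integrable wt_id_integrable wt_sq_integrable] evid_pos
    by (intro nn_integral_cong) (simp add: evid_def pmean_def pvar_def)
  also have "\<dots> = (\<integral>\<^sup>+y. ennreal (evid a b y * (norm (\<beta> *\<^sub>R pmean a b y - \<nu> y))\<^sup>2) \<partial>lborel)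
      + ennreal (\<beta>\<^sup>2) * (\<integral>\<^sup>+y. ennreal (pvar a b y) \<partial>lborel)"
    by (subst nn_integral_add) (auto simp: nn_integral_cmult)
  finally show ?thesis .
qed

lemma nn_integral_pvar: "(\<integral>\<^sup>+y. ennreal (pvar a b y) \<partial>lborel) = ennreal (mmse a b)"
  and mmse_pos: "0 < mmse a b"
proof -
  let ?I = "\<integral>\<^sup>+y. ennreal (pvar a b y) \<partial>lborel"
  \<comment> \<open>The constant estimator 0 has mean squared error equal to the second moment of
    \<open>q0\<close>, which bounds the minimal one.\<close>
  have "?I \<le> (\<integral>\<^sup>+x. \<integral>\<^sup>+y. ennreal (wt a b y x * (norm x)\<^sup>2) \<partial>lborel \<partial>lborel)"
    using nn_integral_wt_sq[of "\<lambda>_. 0" 1] by simp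
  also have "\<dots> = (\<integral>\<^sup>+x. \<integral>\<^sup>+y. ennreal (q0 x * (norm x)\<^sup>2) * ennreal (gauss_pdf (a *\<^sub>R x) b y) \<partial>lborel \<partial>lborel)"
    by (intro nn_integral_cong)
      (simp add: wt_def q0_nonneg gauss_pdf_nonneg ennreal_mult'[symmetric] mult_ac)
  also have "\<dots> = (\<integral>\<^sup>+x. ennreal (q0 x * (norm x)\<^sup>2) \<partial>lborel)"
    using b by (subst nn_integral_cmult) (auto simp: nn_integral_gauss_pdf)
  finally have fin: "?I < \<infinity>" using q0_second by (rule le_less_trans)
  then show eq: "?I = ennreal (mmse a b)" by (simp add: mmse_def)
  have "?I \<noteq> 0"
  proof
    assume "?I = 0"
    then have "AE y in lborel. ennreal (pvar a b y) = 0"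
      by (subst (asm) nn_integral_0_iff_AE) auto
    then have "AE y in (lborel :: (real^'d) measure). False"
      by eventually_elim (use pvar_pos in \<open>auto simp: ennreal_eq_0_iff not_le[symmetric]\<close>)
    then show False by (simp add: eventually_False ae_filter_eq_bot_iff)
  qed
  then show "0 < mmse a b"
    using eq by (metis ennreal_eq_0_iff not_le)
qed

text \<open>Differentiation under the integral without a limit theorem: integrating the uniform
  Taylor bound against \<open>q0\<close> gives a remainder of order \<open>(norm h)\<^sup>2\<close>.
  In \<open>C\<close>, the factor \<open>c\<close> is the peak of the kernel and the other factor is
  the Taylor constant.\<close>

lemma GDERIV_evid: "GDERIV (evid a b) y :> - (evid a b y / b) *\<^sub>R (y - a *\<^sub>R pmean a b y)"
proof -
  define c where "c = (2 * pi * b) powr (- real CARD('d) / 2)"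
  define D where "D = - (evid a b y / b) *\<^sub>R (y - a *\<^sub>R pmean a b y)"
  define C where "C = c * (3 / (2 * b))"
  have c: "0 \<le> c" by (simp add: c_def)
  have D: "h \<bullet> D = (\<integral>x. - (wt a b y x * ((y - a *\<^sub>R x) \<bullet> h) / b) \<partial>lborel)"
    and Di: "integrable lborel (\<lambda>x. wt a b y x * ((y - a *\<^sub>R x) \<bullet> h) / b)" for h
  proof -
    have eq: "wt a b y x * ((y - a *\<^sub>R x) \<bullet> h) = wt a b y x * (y \<bullet> h) - (wt a b y x *\<^sub>R x) \<bullet> (a *\<^sub>R h)" for x
      by (simp add: inner_diff_left algebra_simps)
    show "integrable lborel (\<lambda>x. wt a b y x * ((y - a *\<^sub>R x) \<bullet> h) / b)"
      unfolding eq using wt_integrable wt_id_integrable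
      by (simp del: inner_scaleR_left inner_scaleR_right)
    have "(\<integral>x. - (wt a b y x * ((y - a *\<^sub>R x) \<bullet> h) / b) \<partial>lborel)
       = - ((evid a b y * (y \<bullet> h) - (evid a b y *\<^sub>R pmean a b y) \<bullet> (a *\<^sub>R h)) / b)"
      unfolding eq using wt_integrable wt_id_integrable evid_pos[of y]
      by (simp del: inner_scaleR_left inner_scaleR_right add: evid_def[symmetric] pmean_def)
    then show "h \<bullet> D = (\<integral>x. - (wt a b y x * ((y - a *\<^sub>R x) \<bullet> h) / b) \<partial>lborel)"
      by (simp add: D_def inner_diff_right inner_commute algebra_simps diff_divide_distrib)
  qed
  have bound: "\<bar>evid a b (y + h) - evid a b y - h \<bullet> D\<bar> \<le> C * (norm h)\<^sup>2" for h
  proof -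
    have "\<bar>evid a b (y + h) - evid a b y - h \<bullet> D\<bar>
        = \<bar>\<integral>x. wt a b (y + h) x - wt a b y x + wt a b y x * ((y - a *\<^sub>R x) \<bullet> h) / b \<partial>lborel\<bar>"
      unfolding D evid_def using wt_integrable Di[of h] by simp
    also have "\<dots> \<le> (\<integral>x. C * (norm h)\<^sup>2 * q0 x \<partial>lborel)"
    proof (rule order_trans[OF integral_abs_bound], rule integral_mono)
      fix x :: "real^'d"
      have gp: "gauss_pdf (a *\<^sub>R x) b z = c * exp (- (norm (z - a *\<^sub>R x))\<^sup>2 / (2 * b))" for z :: "real^'d"
        by (simp add: gauss_pdf_def c_def)
      have alg: "q * (c * e1) - q * (c * e0) + q * (c * e0) * t / b = q * c * (e1 - e0 * (1 - t / b))"
        for q c e0 e1 t b :: real by (simp add: algebra_simps)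
      have yh: "y + h - a *\<^sub>R x = y - a *\<^sub>R x + h" by simp
      have "wt a b (y + h) x - wt a b y x + wt a b y x * ((y - a *\<^sub>R x) \<bullet> h) / b
        = q0 x * c * (exp (- (norm (y - a *\<^sub>R x + h))\<^sup>2 / (2 * b))
            - exp (- (norm (y - a *\<^sub>R x))\<^sup>2 / (2 * b)) * (1 - ((y - a *\<^sub>R x) \<bullet> h) / b))"
        by (simp only: wt_def gp yh alg)
      also have "\<bar>\<dots>\<bar> \<le> q0 x * c * (3 / (2 * b) * (norm h)\<^sup>2)"
        unfolding abs_mult[of "q0 x * c"] abs_of_nonneg[OF mult_nonneg_nonneg[OF q0_nonneg c]]
        by (intro mult_left_mono gauss_taylor_bound b mult_nonneg_nonneg q0_nonneg c)
      finally show "\<bar>wt a b (y + h) x - wt a b y x + wt a b y x * ((y - a *\<^sub>R x) \<bullet> h) / b\<bar>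
          \<le> C * (norm h)\<^sup>2 * q0 x" by (simp add: C_def mult_ac)
    qed (use wt_integrable Di[of h] q0_integrable in auto)
    also have "\<dots> = C * (norm h)\<^sup>2" by (simp add: q0_integral)
    finally show ?thesis .
  qed
  have "(\<lambda>h. norm (evid a b (y + h) - evid a b y - h \<bullet> D) / norm h) \<midarrow>0\<rightarrow> 0"
  proof (rule tendsto_sandwich[of "\<lambda>_. 0" _ _ "\<lambda>h. C * norm h"])
    show "\<forall>\<^sub>F h in at 0. norm (evid a b (y + h) - evid a b y - h \<bullet> D) / norm h \<le> C * norm h"
      using bound by (intro always_eventually allI) (auto simp: divide_le_eq power2_eq_square mult.assoc)
    show "(\<lambda>h::real^'d. C * norm h) \<midarrow>0\<rightarrow> 0"
      by (auto intro!: tendsto_eq_intros)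
  qed auto
  then have "(evid a b has_derivative (\<lambda>h. h \<bullet> D)) (at y)"
    by (simp add: has_derivative_at bounded_linear_inner_left)
  then show ?thesis by (simp add: gderiv_def D_def)
qed

text \<open>\<open>score\<close> picks some gradient of the logarithm, so uniqueness of gradients is
  needed to identify it with the computed one.\<close>

lemma tweedie_score: "score (evid a b) y = - (1 / b) *\<^sub>R (y - a *\<^sub>R pmean a b y)"
proof -
  have G: "GDERIV (\<lambda>z. ln (evid a b z)) y :> - (1 / b) *\<^sub>R (y - a *\<^sub>R pmean a b y)"
    by (rule GDERIV_subst[OF GDERIV_DERIV_compose[OF GDERIV_evid DERIV_ln[OF evid_pos]]])
      (use evid_pos[of y] in simp)
  have "D = E" if "GDERIV f y :> D" "GDERIV f y :> E" for f :: "real^'d \<Rightarrow> real" and D E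
    using has_derivative_unique[OF that[unfolded gderiv_def]]
    by (metis inner_commute vector_eq_ldot)
  with G show ?thesis
    unfolding score_def by (metis (no_types, lifting) someI_ex)
qed

text \<open>The noise energy of \<open>y\<close> given \<open>x\<close> is split around the
  posterior mean: with \<open>\<beta> = a\<close> and \<open>\<nu>\<close> the identity, the bias at
  \<open>y\<close> is \<open>b\<close> times the score, by Tweedie's formula, and the variance part
  is \<open>a\<^sup>2 * mmse a b\<close>.\<close>

lemma fisher_mmse:
  "b * real CARD('d) = b\<^sup>2 * (\<integral>y. evid a b y * (norm (score (evid a b) y))\<^sup>2 \<partial>lborel) + a\<^sup>2 * mmse a b"
proof -
  let ?f = "\<lambda>y. evid a b y * (norm (score (evid a b) y))\<^sup>2"
  have f0: "0 \<le> ?f y" for y using evid_pos[of y] by simp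
  have [measurable]: "?f \<in> borel_measurable borel" unfolding tweedie_score by measurable
  have f: "evid a b y * (norm (a *\<^sub>R pmean a b y - y))\<^sup>2 = b\<^sup>2 * ?f y" for y
    using b by (simp add: tweedie_score power_mult_distrib norm_minus_commute power_divide)
  have "ennreal (b * real CARD('d)) = (\<integral>\<^sup>+x. ennreal (q0 x) * ennreal (b * real CARD('d)) \<partial>lborel)"
    by (subst nn_integral_multc) (auto simp: q0_mass)
  also have "\<dots> = (\<integral>\<^sup>+x. ennreal (q0 x) * (\<integral>\<^sup>+y. ennreal (gauss_pdf (a *\<^sub>R x) b y * (norm (y - a *\<^sub>R x))\<^sup>2) \<partial>lborel) \<partial>lborel)"
    by (simp add: nn_integral_gauss_pdf_sq[OF b])
  also have "\<dots> = (\<integral>\<^sup>+x. \<integral>\<^sup>+y. ennreal (wt a b y x * (norm (a *\<^sub>R x - y))\<^sup>2) \<partial>lborel \<partial>lborel)"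
    by (subst nn_integral_cmult[symmetric])
      (auto intro!: nn_integral_cong simp: ennreal_mult'[symmetric] q0_nonneg wt_def mult_ac norm_minus_commute)
  also have "\<dots> = ennreal (b\<^sup>2) * (\<integral>\<^sup>+y. ennreal (?f y) \<partial>lborel) + ennreal (a\<^sup>2) * ennreal (mmse a b)"
    unfolding nn_integral_wt_sq[of "\<lambda>y. y" a, simplified] f nn_integral_pvar
    by (subst nn_integral_cmult[symmetric]) (auto simp: ennreal_mult')
  finally have e: "ennreal (b * real CARD('d)) = \<dots>" .
  \<comment> \<open>Finiteness of the Fisher information is read off the identity: its left side is
    real and \<open>b\<^sup>2\<close> is positive.\<close>
  have fin: "(\<integral>\<^sup>+y. ennreal (?f y) \<partial>lborel) \<noteq> top"
    using e b by (auto simp: ennreal_mult_top)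
  then have "integrable lborel ?f"
    using f0 fin by (intro integrableI_nonneg) (auto simp: less_top)
  then have "(\<integral>\<^sup>+y. ennreal (?f y) \<partial>lborel) = ennreal (\<integral>y. ?f y \<partial>lborel)"
    using f0 by (intro nn_integral_eq_integral) auto
  with e show ?thesis
    using b mmse_pos f0
    by (simp add: ennreal_mult'[symmetric] ennreal_plus[symmetric] integral_nonneg_AE del: ennreal_plus)
qed

end

text \<open>The positive part of the expectation of \<open>ln q0\<close>, whose value is minus the
  entropy. It may be infinite and stays extended, while the negative part becomes the real number
  \<open>negent\<close>.\<close>

definition posent :: ennreal where
  "posent = (\<integral>\<^sup>+x. ennreal (q0 x) * ennreal (ln (q0 x)) \<partial>lborel)"

definition negent :: real where
  "negent = enn2real (\<integral>\<^sup>+x. ennreal (q0 x) * ennreal (- ln (q0 x)) \<partial>lborel)"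

text \<open>Gibbs' inequality against the standard Gaussian keeps the negative part of the entropy
  integrand integrable.\<close>

lemma nn_integral_negent:
  "(\<integral>\<^sup>+x. ennreal (q0 x) * ennreal (- ln (q0 x)) \<partial>lborel) = ennreal negent"
proof -
  let ?g = "\<lambda>x::real^'d. gauss_pdf 0 1 x"
  let ?c = "real CARD('d) / 2 * ln (2 * pi)"
  \<comment> \<open>Obtained from \<open>ln t \<le> t - 1\<close> at \<open>t = ?g x / q0 x\<close>:
    the first term is the ratio times \<open>q0\<close>, and the other two are
    \<open>- ln (?g x)\<close> times \<open>q0\<close>.\<close>
  let ?B = "\<lambda>x. ?g x + ?c * q0 x + q0 x * (norm x)\<^sup>2 * (1 / 2)"
  have c: "0 \<le> ?c" using pi_gt3 by (intro mult_nonneg_nonneg ln_ge_zero) auto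
  have le: "q0 x * max 0 (- ln (q0 x)) \<le> ?B x" for x
  proof (cases "q0 x = 0")
    case True
    then show ?thesis by (simp add: gauss_pdf_nonneg)
  next
    case False
    then have q: "0 < q0 x" using q0_nonneg[of x] by simp
    have g: "0 < ?g x" by (simp add: gauss_pdf_pos)
    have "ln (?g x / q0 x) \<le> ?g x / q0 x - 1"
      using q g by (intro ln_le_minus_one) auto
    then have "- ln (q0 x) \<le> ?g x / q0 x + (?c + (norm x)\<^sup>2 / 2)"
      using q g by (simp add: ln_div ln_gauss_pdf)
    then have "q0 x * (- ln (q0 x)) \<le> q0 x * (?g x / q0 x + (?c + (norm x)\<^sup>2 / 2))"
      using q by (intro mult_left_mono) auto
    also have "\<dots> = ?B x" using q by (simp add: field_simps)
    finally have "q0 x * (- ln (q0 x)) \<le> ?B x" .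
    moreover have "0 \<le> ?B x"
      using q g mult_nonneg_nonneg[OF c q0_nonneg[of x]] by (intro add_nonneg_nonneg) auto
    ultimately show ?thesis by (auto simp: max_def)
  qed
  have "integrable lborel ?g"
    by (intro integrableI_nonneg) (auto simp: gauss_pdf_nonneg nn_integral_gauss_pdf)
  then have B: "integrable lborel ?B"
    using q0_integrable q0_sq_integrable by simp
  have "(\<integral>\<^sup>+x. ennreal (q0 x) * ennreal (- ln (q0 x)) \<partial>lborel)
      = (\<integral>\<^sup>+x. ennreal (q0 x * max 0 (- ln (q0 x))) \<partial>lborel)"
    by (simp add: ennreal_mult' q0_nonneg ennreal_max_0')
  also have "\<dots> \<le> (\<integral>\<^sup>+x. ennreal (?B x) \<partial>lborel)"
    using le by (intro nn_integral_mono ennreal_leI) auto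
  also have "\<dots> < \<infinity>"
    using B unfolding real_integrable_def by (auto simp: less_top)
  finally show ?thesis by (simp add: negent_def)
qed

section \<open>Mass and second moment of a noisy observation\<close>

lemma nn_integral_wt:
  assumes b: "0 < b"
  shows "(\<integral>\<^sup>+x. \<integral>\<^sup>+y. ennreal (wt a b y x) \<partial>lborel \<partial>lborel) = 1"
proof -
  have "(\<integral>\<^sup>+x. \<integral>\<^sup>+y. ennreal (wt a b y x) \<partial>lborel \<partial>lborel)
     = (\<integral>\<^sup>+x. ennreal (q0 x) * (\<integral>\<^sup>+y. ennreal (gauss_pdf (a *\<^sub>R x) b y) \<partial>lborel) \<partial>lborel)"
    by (subst nn_integral_cmult[symmetric]) (auto simp: wt_def ennreal_mult' q0_nonneg)
  then show ?thesis using b by (simp add: nn_integral_gauss_pdf q0_mass)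
qed

lemma nn_integral_wt_norm:
  assumes b: "0 < b"
  shows "(\<integral>\<^sup>+x. \<integral>\<^sup>+y. ennreal (wt a b y x * (norm y)\<^sup>2) \<partial>lborel \<partial>lborel)
    = ennreal (b * real CARD('d) + a\<^sup>2 * (\<integral>x. q0 x * (norm x)\<^sup>2 \<partial>lborel))"
proof -
  have "(\<integral>\<^sup>+x. \<integral>\<^sup>+y. ennreal (wt a b y x * (norm y)\<^sup>2) \<partial>lborel \<partial>lborel)
     = (\<integral>\<^sup>+x. ennreal (q0 x) * (\<integral>\<^sup>+y. ennreal (gauss_pdf (a *\<^sub>R x) b y * (norm (y - 0))\<^sup>2) \<partial>lborel) \<partial>lborel)"
    by (subst nn_integral_cmult[symmetric]) (auto simp: wt_def ennreal_mult' q0_nonneg mult.assoc)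
  also have "\<dots> = (\<integral>\<^sup>+x. ennreal (b * real CARD('d) * q0 x + a\<^sup>2 * (q0 x * (norm x)\<^sup>2)) \<partial>lborel)"
    unfolding nn_integral_gauss_pdf_sq[OF b]
    by (intro nn_integral_cong)
      (simp add: ennreal_mult'[symmetric] q0_nonneg power_mult_distrib algebra_simps del: ennreal_plus)
  also have "\<dots> = ennreal (b * real CARD('d) + a\<^sup>2 * (\<integral>x. q0 x * (norm x)\<^sup>2 \<partial>lborel))"
    using b q0_integrable q0_sq_integrable
    by (subst nn_integral_eq_integral) (auto simp: q0_nonneg q0_integral add_nonneg_nonneg)
  finally show ?thesis .
qed

text \<open>The real part of the constant: normalising factors of the prior and of the terminal
  forward law, the optimal variance \<open>mmse / d\<close> of step 1, half the second moment of
  \<open>x K\<close>, and \<open>negent\<close>. The possibly infinite \<open>posent\<close> is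
  added separately.\<close>

definition kl_const :: "(nat \<Rightarrow> real) \<Rightarrow> nat \<Rightarrow> real" where
  "kl_const beta N =
     real CARD('d) / 2 * (ln (2 * pi) - ln (2 * pi * bbar beta N)
       + ln (2 * pi * (mmse (sqrt (abar beta 1)) (bbar beta 1) / real CARD('d))))
     + (bbar beta N * real CARD('d) + abar beta N * (\<integral>x. q0 x * (norm x)\<^sup>2 \<partial>lborel)) / 2 - negent"

end

subsection \<open>The forward process\<close>

locale diffusion = data_density q0 for q0 :: "real^'d \<Rightarrow> real" +
  fixes beta :: "nat \<Rightarrow> real" and N :: nat and lam :: "nat \<Rightarrow> nat \<Rightarrow> real"
    and K :: nat and tau :: "nat \<Rightarrow> nat"
  assumes beta: "\<And>n. n \<in> {1..N} \<Longrightarrow> 0 < beta n \<and> beta n < 1"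
    and lam: "\<And>s t. 1 \<le> s \<Longrightarrow> s < t \<Longrightarrow> t \<le> N \<Longrightarrow> 0 < (lam s t)\<^sup>2 \<and> (lam s t)\<^sup>2 \<le> bbar beta s"
    and traj: "trajectory N K tau"
begin

abbreviation A :: "nat \<Rightarrow> real" where "A k \<equiv> abar beta (tau k)"
abbreviation B :: "nat \<Rightarrow> real" where "B k \<equiv> bbar beta (tau k)"
abbreviation \<Lambda> :: "nat \<Rightarrow> real" where "\<Lambda> k \<equiv> (lam (tau (k - 1)) (tau k))\<^sup>2"
abbreviation mt :: "nat \<Rightarrow> real^'d \<Rightarrow> real^'d \<Rightarrow> real^'d" where
  "mt k \<equiv> mu_tilde beta lam (tau (k - 1)) (tau k)"
abbreviation \<Omega> :: "(nat \<Rightarrow> real^'d) measure" where "\<Omega> \<equiv> PiM {0..K} (\<lambda>_. lborel)"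

text \<open>\<open>cx\<close> and \<open>c0\<close> are the coefficients of \<open>x k\<close> and
  \<open>x 0\<close> in the kernel mean; uncertainty about \<open>x 0\<close> enters the optimal
  variance scaled by the square of \<open>c0\<close>.\<close>

definition cx :: "nat \<Rightarrow> real" where
  "cx k = sqrt (B (k - 1) - \<Lambda> k) / sqrt (B k)"

definition c0 :: "nat \<Rightarrow> real" where
  "c0 k = sqrt (A (k - 1)) - cx k * sqrt (A k)"

lemma mt_eq: "mt k y x = cx k *\<^sub>R y + c0 k *\<^sub>R x"
  by (simp add: mu_tilde_def cx_def c0_def algebra_simps)

lemma K_pos: "1 \<le> K" and tau_1: "tau 1 = 1" and tau_K: "tau K = N"
  using traj by (auto simp: trajectory_def)

lemma tau_mono:
  assumes "1 \<le> i" "i \<le> j" "j \<le> K"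
  shows "tau i \<le> tau j"
  using assms(2,1,3)
proof (induction j rule: dec_induct)
  case (step j)
  then have "tau j < tau (Suc j)" using traj by (auto simp: trajectory_def)
  with step show ?case by auto
qed simp

lemma tau_range: "1 \<le> k \<Longrightarrow> k \<le> K \<Longrightarrow> tau k \<in> {1..N}"
  using tau_mono[of 1 k] tau_mono[of k K] tau_1 tau_K by auto

lemma tau_step: "2 \<le> k \<Longrightarrow> k \<le> K \<Longrightarrow> tau (k - 1) < tau k"
  using traj by (cases k) (auto simp: trajectory_def)

lemma abar_range:
  assumes "1 \<le> n" "n \<le> N"
  shows "0 < abar beta n \<and> abar beta n < 1"
  using assms
proof (induction n rule: dec_induct)
  case base
  then show ?case using beta[of 1] by (simp add: abar_def)
next
  case (step n)
  then have n: "0 < abar beta n" "abar beta n < 1" "0 < 1 - beta (Suc n)" "1 - beta (Suc n) < 1"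
    using beta[of "Suc n"] by auto
  then have "abar beta n * (1 - beta (Suc n)) < 1 * 1"
    by (intro mult_strict_mono) auto
  moreover have "0 < abar beta n * (1 - beta (Suc n))" using n by simp
  ultimately have "0 < abar beta n * (1 - beta (Suc n))" "abar beta n * (1 - beta (Suc n)) < 1" by auto
  then show ?case by (simp add: abar_def mult.commute)
qed

lemma A_pos: "1 \<le> k \<Longrightarrow> k \<le> K \<Longrightarrow> 0 < A k" and B_pos: "1 \<le> k \<Longrightarrow> k \<le> K \<Longrightarrow> 0 < B k"
  using tau_range[of k] abar_range[of "tau k"] by (auto simp: bbar_def)

lemma \<Lambda>_pos: "2 \<le> k \<Longrightarrow> k \<le> K \<Longrightarrow> 0 < \<Lambda> k" and \<Lambda>_le: "2 \<le> k \<Longrightarrow> k \<le> K \<Longrightarrow> \<Lambda> k \<le> B (k - 1)"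
  using tau_step[of k] tau_range[of k] tau_range[of "k - 1"] lam[of "tau (k - 1)" "tau k"] by auto

definition \<gamma> :: "nat \<Rightarrow> real^'d \<Rightarrow> real^'d \<Rightarrow> ennreal" where
  "\<gamma> k x y = ennreal (gauss_pdf (sqrt (A k) *\<^sub>R x) (B k) y)"

definition \<kappa> :: "nat \<Rightarrow> real^'d \<Rightarrow> real^'d \<Rightarrow> real^'d \<Rightarrow> ennreal" where
  "\<kappa> k x y z = ennreal (gauss_pdf (mt k y x) (\<Lambda> k) z)"

lemma fwd_chain: "ennreal (fwd_joint beta lam N K tau q0 x) = chain (\<lambda>x. ennreal (q0 x)) \<gamma> \<kappa> 1 K x"
  unfolding fwd_joint_def chain_def \<gamma>_def \<kappa>_def tau_K
  by (simp add: ennreal_mult' ennreal_mult'' prod_ennreal gauss_pdf_nonneg q0_nonneg prod_nonneg numeral_2_eq_2)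

lemma wt_chain: "ennreal (q0 x) * \<gamma> k x y = ennreal (wt (sqrt (A k)) (B k) y x)"
  by (simp add: wt_def \<gamma>_def ennreal_mult' q0_nonneg)

lemma q0_meas': "(\<lambda>x. ennreal (q0 x)) \<in> borel_measurable borel"
  by measurable

lemma \<gamma>_meas: "(\<lambda>(a, b). \<gamma> k a b) \<in> borel_measurable (borel \<Otimes>\<^sub>M borel)"
  unfolding \<gamma>_def by measurable

lemma \<kappa>_meas: "(\<lambda>(a, b, c). \<kappa> k a b c) \<in> borel_measurable (borel \<Otimes>\<^sub>M borel \<Otimes>\<^sub>M borel)"
  unfolding \<kappa>_def mt_eq by measurable

lemma \<kappa>_mass: "2 \<le> k \<Longrightarrow> k \<le> K \<Longrightarrow> (\<integral>\<^sup>+c. \<kappa> k a b c \<partial>lborel) = 1"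
  unfolding \<kappa>_def using \<Lambda>_pos by (intro nn_integral_gauss_pdf)

text \<open>The form of \<open>mu_tilde\<close> is made for this: variances combine to
  \<open>(cx k)\<^sup>2 * B k + \<Lambda> k = B (k - 1)\<close>, where
  \<open>\<Lambda> k \<le> B (k - 1)\<close> lets the root be squared away, and the coefficients of
  \<open>x 0\<close> combine to \<open>sqrt (A (k - 1))\<close>.\<close>

lemma \<gamma>\<kappa>_conv:
  assumes "2 \<le> k" "k \<le> K"
  shows "(\<integral>\<^sup>+b. \<gamma> k a b * \<kappa> k a b c \<partial>lborel) = \<gamma> (k - 1) a c"
proof -
  have "(cx k)\<^sup>2 * B k + \<Lambda> k = B (k - 1)"
    using assms \<Lambda>_le[of k] B_pos[of k] by (simp add: cx_def power_divide)
  moreover have "cx k *\<^sub>R sqrt (A k) *\<^sub>R a + c0 k *\<^sub>R a = sqrt (A (k - 1)) *\<^sub>R a"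
    by (simp add: c0_def algebra_simps)
  ultimately show ?thesis
    unfolding \<gamma>_def \<kappa>_def mt_eq
    using nn_integral_gauss_pdf_mult[OF B_pos[of k] \<Lambda>_pos[of k], of "sqrt (A k) *\<^sub>R a" "cx k" "c0 k *\<^sub>R a" c] assms
    by simp
qed

section \<open>The law of the forward process and its marginals\<close>

definition P :: "(nat \<Rightarrow> real^'d) measure" where
  "P = density \<Omega> (\<lambda>x. ennreal (fwd_joint beta lam N K tau q0 x))"

lemma fwd_meas [measurable]: "fwd_joint beta lam N K tau q0 \<in> borel_measurable \<Omega>"
proof -
  have [measurable]: "(\<lambda>x. x k) \<in> borel_measurable \<Omega>" if "k \<le> K" for k
    using that by (intro measurable_coord) auto
  show ?thesis
    unfolding fwd_joint_def mt_eq
    by (intro borel_measurable_times borel_measurable_prod borel_measurable_gauss_pdf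
        measurable_compose[OF _ q0_meas] borel_measurable_add borel_measurable_scaleR) auto
qed

lemma sets_P [measurable_cong, simp]: "sets P = sets \<Omega>"
  by (simp add: P_def)

lemma coord_meas:
  assumes "k \<le> K"
  shows "(\<lambda>x. x k) \<in> borel_measurable P" "(\<lambda>x. x k) \<in> borel_measurable \<Omega>"
proof -
  show "(\<lambda>x. x k) \<in> borel_measurable \<Omega>" using assms by (intro measurable_coord) auto
  then show "(\<lambda>x. x k) \<in> borel_measurable P" using measurable_cong_sets[OF sets_P refl] by blast
qed

lemma nn_integral_P_pair:
  assumes k: "1 \<le> k" "k \<le> K" and h: "(\<lambda>(a, b). h a b) \<in> borel_measurable (borel \<Otimes>\<^sub>M borel)"
  shows "(\<integral>\<^sup>+x. h (x 0) (x k) \<partial>P)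
    = (\<integral>\<^sup>+x. \<integral>\<^sup>+y. ennreal (wt (sqrt (A k)) (B k) y x) * h x y \<partial>lborel \<partial>lborel)"
proof -
  \<comment> \<open>The chain lemmas expect a test function of three points, so \<open>h\<close> is
    padded with a dummy middle argument.\<close>
  have h3: "(\<lambda>(a, b, c). h a c) \<in> borel_measurable (borel \<Otimes>\<^sub>M borel \<Otimes>\<^sub>M (borel :: (real^'d) measure))"
  proof -
    have p: "(\<lambda>z. (fst z, snd (snd z))) \<in> measurable (borel \<Otimes>\<^sub>M borel \<Otimes>\<^sub>M (borel :: (real^'d) measure)) (borel \<Otimes>\<^sub>M borel)"
      by (intro measurable_Pair measurable_fst measurable_compose[OF measurable_snd] measurable_snd)
    show ?thesis
      using measurable_compose[OF p h] by (simp only: case_prod_unfold fst_conv snd_conv)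
  qed
  have m: "(\<lambda>x. (x 0, x k)) \<in> measurable \<Omega> (borel \<Otimes>\<^sub>M borel)"
    using k by (intro measurable_Pair coord_meas) auto
  have hm: "(\<lambda>x. h (x 0) (x k)) \<in> borel_measurable \<Omega>"
    using measurable_compose[OF m h] by (simp only: prod.case)
  have "(\<integral>\<^sup>+x. h (x 0) (x k) \<partial>P) = (\<integral>\<^sup>+x. chain (\<lambda>x. ennreal (q0 x)) \<gamma> \<kappa> 1 K x * h (x 0) (x k) \<partial>\<Omega>)"
    using nn_integral_density[OF measurable_compose[OF fwd_meas measurable_ennreal] hm]
    unfolding P_def fwd_chain .
  also have "\<dots> = (\<integral>\<^sup>+x. \<integral>\<^sup>+y. ennreal (q0 x) * \<gamma> k x y * h x y \<partial>lborel \<partial>lborel)"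
    by (rule chain_pair[where w = "\<lambda>x. ennreal (q0 x)" and \<gamma> = \<gamma> and \<kappa> = \<kappa> and K = K and h = "\<lambda>a b c. h a c", OF q0_meas' \<gamma>_meas \<kappa>_meas h3 \<gamma>\<kappa>_conv \<kappa>_mass k])
  finally show ?thesis by (simp add: wt_chain)
qed

lemma nn_integral_P_triple:
  assumes k: "2 \<le> k" "k \<le> K"
    and h: "(\<lambda>(a, b, c). h a b c) \<in> borel_measurable (borel \<Otimes>\<^sub>M borel \<Otimes>\<^sub>M borel)"
  shows "(\<integral>\<^sup>+x. h (x 0) (x (k - 1)) (x k) \<partial>P)
    = (\<integral>\<^sup>+x. \<integral>\<^sup>+y. ennreal (wt (sqrt (A k)) (B k) y x) * (\<integral>\<^sup>+z. \<kappa> k x y z * h x z y \<partial>lborel) \<partial>lborel \<partial>lborel)"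
proof -
  have m: "(\<lambda>x. (x 0, x (k - 1), x k)) \<in> measurable \<Omega> (borel \<Otimes>\<^sub>M borel \<Otimes>\<^sub>M borel)"
    using k by (intro measurable_Pair coord_meas) auto
  have hm: "(\<lambda>x. h (x 0) (x (k - 1)) (x k)) \<in> borel_measurable \<Omega>"
    using measurable_compose[OF m h] by (simp only: prod.case)
  have "(\<integral>\<^sup>+x. h (x 0) (x (k - 1)) (x k) \<partial>P)
      = (\<integral>\<^sup>+x. chain (\<lambda>x. ennreal (q0 x)) \<gamma> \<kappa> 1 K x * h (x 0) (x (k - 1)) (x k) \<partial>\<Omega>)"
    using nn_integral_density[OF measurable_compose[OF fwd_meas measurable_ennreal] hm]
    unfolding P_def fwd_chain .
  also have "\<dots> = (\<integral>\<^sup>+x. \<integral>\<^sup>+y. ennreal (q0 x) * \<gamma> k x y * (\<integral>\<^sup>+z. \<kappa> k x y z * h x z y \<partial>lborel) \<partial>lborel \<partial>lborel)"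
    by (rule chain_triple[where w = "\<lambda>x. ennreal (q0 x)" and \<gamma> = \<gamma> and \<kappa> = \<kappa> and K = K and h = h, OF q0_meas' \<gamma>_meas \<kappa>_meas h \<gamma>\<kappa>_conv \<kappa>_mass k])
  finally show ?thesis by (simp add: wt_chain)
qed

lemma nn_integral_P_first:
  assumes [measurable]: "F \<in> borel_measurable borel"
  shows "(\<integral>\<^sup>+x. F (x 0) \<partial>P) = (\<integral>\<^sup>+x. ennreal (q0 x) * F x \<partial>lborel)"
proof -
  have "(\<integral>\<^sup>+x. F (x 0) \<partial>P)
      = (\<integral>\<^sup>+x. \<integral>\<^sup>+y. ennreal (wt (sqrt (A 1)) (B 1) y x) * F x \<partial>lborel \<partial>lborel)"
    by (rule nn_integral_P_pair[where h = "\<lambda>x y. F x"]) (use K_pos in auto)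
  also have "\<dots> = (\<integral>\<^sup>+x. \<integral>\<^sup>+y. (ennreal (q0 x) * F x) * ennreal (gauss_pdf (sqrt (A 1) *\<^sub>R x) (B 1) y) \<partial>lborel \<partial>lborel)"
    by (simp add: wt_def ennreal_mult' q0_nonneg mult_ac)
  also have "\<dots> = (\<integral>\<^sup>+x. ennreal (q0 x) * F x \<partial>lborel)"
    using B_pos[of 1] K_pos by (subst nn_integral_cmult) (auto simp: nn_integral_gauss_pdf)
  finally show ?thesis .
qed

lemma prob_P: "prob_space P"
proof
  have "emeasure P (space P) = (\<integral>\<^sup>+x. (\<lambda>_. 1) (x 0) \<partial>P)" by simp
  also have "\<dots> = 1" by (subst nn_integral_P_first) (auto simp: q0_mass)
  finally show "emeasure P (space P) = 1" .
qed

section \<open>Expected squared deviations under the forward law\<close>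

lemma nn_integral_P_last_dev:
  "(\<integral>\<^sup>+x. ennreal ((norm (x K - sqrt (abar beta N) *\<^sub>R x 0))\<^sup>2) \<partial>P) = ennreal (bbar beta N * real CARD('d))"
proof -
  have B: "0 < B K" using B_pos K_pos by simp
  have "(\<integral>\<^sup>+x. ennreal ((norm (x K - sqrt (A K) *\<^sub>R x 0))\<^sup>2) \<partial>P)
      = (\<integral>\<^sup>+x. \<integral>\<^sup>+y. ennreal (wt (sqrt (A K)) (B K) y x) * ennreal ((norm (y - sqrt (A K) *\<^sub>R x))\<^sup>2) \<partial>lborel \<partial>lborel)"
    by (rule nn_integral_P_pair[where h = "\<lambda>x y. ennreal ((norm (y - sqrt (A K) *\<^sub>R x))\<^sup>2)"]) (use K_pos in auto)
  also have "\<dots> = (\<integral>\<^sup>+x. ennreal (q0 x) * (\<integral>\<^sup>+y. ennreal (gauss_pdf (sqrt (A K) *\<^sub>R x) (B K) y * (norm (y - sqrt (A K) *\<^sub>R x))\<^sup>2) \<partial>lborel) \<partial>lborel)"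
    by (subst nn_integral_cmult[symmetric])
      (auto simp: wt_def ennreal_mult' q0_nonneg gauss_pdf_nonneg mult.assoc)
  also have "\<dots> = ennreal (B K * real CARD('d))"
    by (simp add: nn_integral_gauss_pdf_sq[OF B] nn_integral_multc q0_mass)
  finally show ?thesis by (simp only: tau_K)
qed

lemma nn_integral_P_last:
  "(\<integral>\<^sup>+x. ennreal ((norm (x K))\<^sup>2) \<partial>P)
    = ennreal (bbar beta N * real CARD('d) + abar beta N * (\<integral>x. q0 x * (norm x)\<^sup>2 \<partial>lborel))"
proof -
  have B: "0 < B K" and A: "0 < A K" using B_pos A_pos K_pos by auto
  have "(\<integral>\<^sup>+x. ennreal ((norm (x K))\<^sup>2) \<partial>P)
      = (\<integral>\<^sup>+x. \<integral>\<^sup>+y. ennreal (wt (sqrt (A K)) (B K) y x) * ennreal ((norm y)\<^sup>2) \<partial>lborel \<partial>lborel)"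
    by (rule nn_integral_P_pair[where h = "\<lambda>x y. ennreal ((norm y)\<^sup>2)"]) (use K_pos in auto)
  also have "\<dots> = ennreal (B K * real CARD('d) + A K * (\<integral>x. q0 x * (norm x)\<^sup>2 \<partial>lborel))"
    using nn_integral_wt_norm[OF B, of "sqrt (A K)"] A by (simp add: ennreal_mult' wt_nonneg)
  finally show ?thesis by (simp only: tau_K)
qed

lemma nn_integral_\<kappa>_sq:
  assumes "2 \<le> k" "k \<le> K"
  shows "(\<integral>\<^sup>+z. \<kappa> k x y z * ennreal ((norm (z - u))\<^sup>2) \<partial>lborel)
    = ennreal (\<Lambda> k * real CARD('d) + (norm (mt k y x - u))\<^sup>2)"
  using nn_integral_gauss_pdf_sq[OF \<Lambda>_pos[OF assms], of "mt k y x" u]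
  by (simp add: \<kappa>_def ennreal_mult' gauss_pdf_nonneg)

lemma nn_integral_P_fwd_dev:
  assumes k: "2 \<le> k" "k \<le> K"
  shows "(\<integral>\<^sup>+x. ennreal ((norm (x (k - 1) - mt k (x k) (x 0)))\<^sup>2) \<partial>P) = ennreal (\<Lambda> k * real CARD('d))"
proof -
  have "(\<integral>\<^sup>+x. ennreal ((norm (x (k - 1) - mt k (x k) (x 0)))\<^sup>2) \<partial>P)
      = (\<integral>\<^sup>+x. \<integral>\<^sup>+y. ennreal (wt (sqrt (A k)) (B k) y x) *
          (\<integral>\<^sup>+z. \<kappa> k x y z * ennreal ((norm (z - mt k y x))\<^sup>2) \<partial>lborel) \<partial>lborel \<partial>lborel)"
    by (rule nn_integral_P_triple[OF k, where h = "\<lambda>x z y. ennreal ((norm (z - mt k y x))\<^sup>2)"])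
      (unfold mt_eq, measurable)
  also have "\<dots> = (\<integral>\<^sup>+x. \<integral>\<^sup>+y. ennreal (wt (sqrt (A k)) (B k) y x) \<partial>lborel \<partial>lborel) * ennreal (\<Lambda> k * real CARD('d))"
    by (simp add: nn_integral_\<kappa>_sq[OF k] nn_integral_multc)
  finally show ?thesis
    using nn_integral_wt[OF B_pos] k by simp
qed

text \<open>The left side is a total variance: kernel noise plus the posterior uncertainty about
  \<open>x 0\<close> carried through \<open>c0 k\<close>. The match with the Fisher form rests on
  \<open>sqrt (B k) * c0 k = sqrt (A k) * \<sigma>\<close>, with \<open>\<sigma>\<close> the
  difference of roots in \<open>sigma_star_sq\<close>, and on \<open>fisher_mmse\<close>.\<close>

lemma sigma_star_mmse:
  assumes k: "2 \<le> k" "k \<le> K"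
  shows "\<Lambda> k * real CARD('d) + (c0 k)\<^sup>2 * mmse (sqrt (A k)) (B k)
    = real CARD('d) * sigma_star_sq beta lam q0 (tau (k - 1)) (tau k)"
proof -
  have A: "0 < A k" and B: "0 < B k" and A': "0 < A (k - 1)"
    using A_pos[of k] B_pos[of k] A_pos[of "k - 1"] k by auto
  have F: "fisher beta q0 (tau k) = (\<integral>y. evid (sqrt (A k)) (B k) y * (norm (score (evid (sqrt (A k)) (B k)) y))\<^sup>2 \<partial>lborel)"
  proof -
    have "marg beta q0 (tau k) = evid (sqrt (A k)) (B k)"
      by (simp add: fun_eq_iff marg_def evid_def wt_def)
    then show ?thesis by (simp add: fisher_def)
  qed
  define \<sigma> where "\<sigma> = sqrt (B k / (A k / A (k - 1))) - sqrt (B (k - 1) - \<Lambda> k)"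
  have m: "A k * mmse (sqrt (A k)) (B k) = B k * (real CARD('d) - B k * fisher beta q0 (tau k))"
    using fisher_mmse[OF B, of "sqrt (A k)"] A by (simp add: F power2_eq_square algebra_simps)
  have "sqrt (B k) * c0 k = sqrt (A k) * \<sigma>"
    using A B A' by (simp add: \<sigma>_def c0_def cx_def real_sqrt_divide real_sqrt_mult field_simps)
  then have "(sqrt (B k) * c0 k)\<^sup>2 = (sqrt (A k) * \<sigma>)\<^sup>2" by simp
  then have c: "B k * (c0 k)\<^sup>2 = A k * \<sigma>\<^sup>2" using A B by (simp add: power_mult_distrib)
  have "A k * B k * ((c0 k)\<^sup>2 * mmse (sqrt (A k)) (B k))
      = (B k * (c0 k)\<^sup>2) * (A k * mmse (sqrt (A k)) (B k))" by simp
  also have "\<dots> = A k * B k * (\<sigma>\<^sup>2 * (real CARD('d) - B k * fisher beta q0 (tau k)))"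
    unfolding c m by simp
  finally have "(c0 k)\<^sup>2 * mmse (sqrt (A k)) (B k) = \<sigma>\<^sup>2 * (real CARD('d) - B k * fisher beta q0 (tau k))"
    using A B by simp
  moreover have "real CARD('d) * (\<sigma>\<^sup>2 * (1 - B k * fisher beta q0 (tau k) / real CARD('d)))
      = \<sigma>\<^sup>2 * (real CARD('d) - B k * fisher beta q0 (tau k))"
    by (simp add: field_simps)
  ultimately show ?thesis
    unfolding sigma_star_sq_def \<sigma>_def[symmetric] distrib_left
    by (simp only: mult.commute[of "\<Lambda> k"])
qed

text \<open>The sign of \<open>1 - B k * fisher beta q0 (tau k) / d\<close> is not visible in the
  definition; the error form is a sum of a positive and a nonnegative term.\<close>

lemma sigma_star_pos:
  assumes k: "2 \<le> k" "k \<le> K"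
  shows "0 < sigma_star_sq beta lam q0 (tau (k - 1)) (tau k)"
proof -
  have "0 < real CARD('d) * sigma_star_sq beta lam q0 (tau (k - 1)) (tau k)"
    unfolding sigma_star_mmse[OF k, symmetric]
    using \<Lambda>_pos[OF k] mmse_pos[OF B_pos, of k "sqrt (A k)"] k
    by (intro add_pos_nonneg) (auto intro!: mult_nonneg_nonneg)
  then show ?thesis by (simp add: zero_less_mult_iff)
qed

text \<open>Two nested bias-variance decompositions: over \<open>x (k - 1)\<close> given the other
  two points, then over \<open>x 0\<close> given \<open>x k\<close>. The remainder may be infinite;
  it vanishes for the mean
  \<open>cx k *\<^sub>R y + c0 k *\<^sub>R pmean (sqrt (A k)) (B k) y\<close>.\<close>

lemma nn_integral_P_rev_dev:
  assumes k: "2 \<le> k" "k \<le> K" and [measurable]: "\<mu> \<in> borel_measurable borel"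
  shows "(\<integral>\<^sup>+x. ennreal ((norm (x (k - 1) - \<mu> (x k)))\<^sup>2) \<partial>P)
    = ennreal (real CARD('d) * sigma_star_sq beta lam q0 (tau (k - 1)) (tau k))
      + (\<integral>\<^sup>+y. ennreal (evid (sqrt (A k)) (B k) y *
            (norm (c0 k *\<^sub>R pmean (sqrt (A k)) (B k) y - (\<mu> y - cx k *\<^sub>R y)))\<^sup>2) \<partial>lborel)"
proof -
  let ?w = "\<lambda>y x. wt (sqrt (A k)) (B k) y x"
  have B: "0 < B k" using B_pos[of k] k by simp
  have L: "0 < \<Lambda> k" using \<Lambda>_pos k by simp
  let ?E = "\<integral>\<^sup>+y. ennreal (evid (sqrt (A k)) (B k) y *
            (norm (c0 k *\<^sub>R pmean (sqrt (A k)) (B k) y - (\<mu> y - cx k *\<^sub>R y)))\<^sup>2) \<partial>lborel"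
  define g where "g x y = ennreal (?w y x * (norm (c0 k *\<^sub>R x - (\<mu> y - cx k *\<^sub>R y)))\<^sup>2)" for x y
  have [measurable]: "(\<lambda>z. g (f1 z) (f2 z)) \<in> borel_measurable M"
    if [measurable]: "f1 \<in> borel_measurable M" "f2 \<in> borel_measurable M" for f1 f2 and M :: "'z measure"
    unfolding g_def by measurable
  have "(\<integral>\<^sup>+x. ennreal ((norm (x (k - 1) - \<mu> (x k)))\<^sup>2) \<partial>P)
      = (\<integral>\<^sup>+x. \<integral>\<^sup>+y. ennreal (?w y x) *
          (\<integral>\<^sup>+z. \<kappa> k x y z * ennreal ((norm (z - \<mu> y))\<^sup>2) \<partial>lborel) \<partial>lborel \<partial>lborel)"
    by (rule nn_integral_P_triple[OF k, where h = "\<lambda>x z y. ennreal ((norm (z - \<mu> y))\<^sup>2)"]) simp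
  also have "\<dots> = (\<integral>\<^sup>+x. \<integral>\<^sup>+y. ennreal (?w y x) * ennreal (\<Lambda> k * real CARD('d)) + g x y \<partial>lborel \<partial>lborel)"
  proof -
    have "mt k y x - \<mu> y = c0 k *\<^sub>R x - (\<mu> y - cx k *\<^sub>R y)" for x y
      unfolding mt_eq by simp
    then show ?thesis
      unfolding nn_integral_\<kappa>_sq[OF k] g_def
      using L by (intro nn_integral_cong)
        (simp only: ennreal_mult' wt_nonneg distrib_left ennreal_plus zero_le_power2 mult_nonneg_nonneg of_nat_0_le_iff less_imp_le)
  qed
  also have "\<dots> = (\<integral>\<^sup>+x. \<integral>\<^sup>+y. ennreal (?w y x) \<partial>lborel \<partial>lborel) * ennreal (\<Lambda> k * real CARD('d))
      + (\<integral>\<^sup>+x. \<integral>\<^sup>+y. g x y \<partial>lborel \<partial>lborel)"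
    by (simp add: nn_integral_add nn_integral_multc)
  also have "(\<integral>\<^sup>+x. \<integral>\<^sup>+y. g x y \<partial>lborel \<partial>lborel) = ennreal ((c0 k)\<^sup>2) * ennreal (mmse (sqrt (A k)) (B k)) + ?E"
    unfolding g_def by (subst nn_integral_wt_sq[OF B]) (auto simp: nn_integral_pvar[OF B] add.commute)
  also have "(\<integral>\<^sup>+x. \<integral>\<^sup>+y. ennreal (?w y x) \<partial>lborel \<partial>lborel) = 1"
    by (rule nn_integral_wt[OF B])
  also have "1 * ennreal (\<Lambda> k * real CARD('d)) + (ennreal ((c0 k)\<^sup>2) * ennreal (mmse (sqrt (A k)) (B k)) + ?E)
      = ennreal (\<Lambda> k * real CARD('d) + (c0 k)\<^sup>2 * mmse (sqrt (A k)) (B k)) + ?E"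
    using L mmse_pos[OF B, of "sqrt (A k)"] by (simp add: ennreal_mult' ennreal_plus add.assoc del: One_nat_def)
  finally show ?thesis by (simp only: sigma_star_mmse[OF k])
qed

lemma nn_integral_P_rev_dev_first:
  assumes [measurable]: "\<mu> \<in> borel_measurable borel"
  shows "(\<integral>\<^sup>+x. ennreal ((norm (x 0 - \<mu> (x 1)))\<^sup>2) \<partial>P)
    = ennreal (mmse (sqrt (abar beta 1)) (bbar beta 1))
      + (\<integral>\<^sup>+y. ennreal (evid (sqrt (abar beta 1)) (bbar beta 1) y *
            (norm (pmean (sqrt (abar beta 1)) (bbar beta 1) y - \<mu> y))\<^sup>2) \<partial>lborel)"
proof -
  have B: "0 < bbar beta 1" using B_pos[of 1] K_pos tau_1 by simp
  have "(\<integral>\<^sup>+x. ennreal ((norm (x 0 - \<mu> (x 1)))\<^sup>2) \<partial>P)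
      = (\<integral>\<^sup>+x. \<integral>\<^sup>+y. ennreal (wt (sqrt (A 1)) (B 1) y x) * ennreal ((norm (x - \<mu> y))\<^sup>2) \<partial>lborel \<partial>lborel)"
    by (rule nn_integral_P_pair[where h = "\<lambda>x y. ennreal ((norm (x - \<mu> y))\<^sup>2)"]) (use K_pos in auto)
  also have "\<dots> = (\<integral>\<^sup>+x. \<integral>\<^sup>+y. ennreal (wt (sqrt (abar beta 1)) (bbar beta 1) y x * (norm (1 *\<^sub>R x - \<mu> y))\<^sup>2) \<partial>lborel \<partial>lborel)"
    unfolding tau_1 by (simp add: ennreal_mult' wt_nonneg)
  finally show ?thesis
    using nn_integral_wt_sq[OF B, where \<nu> = \<mu> and \<beta> = 1 and a = "sqrt (abar beta 1)"]
    by (simp add: nn_integral_pvar[OF B] add.commute del: One_nat_def)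
qed

subsection \<open>The divergence as a function of the reverse parameters\<close>

lemma has_bochner_integral_P_nonneg:
  assumes "u \<in> borel_measurable P" "\<And>x. 0 \<le> u x" "0 \<le> c" "(\<integral>\<^sup>+x. ennreal (u x) \<partial>P) = ennreal c"
  shows "has_bochner_integral P u c"
  using assms nn_integral_eq_integrable[of u P c] by (simp add: has_bochner_integral_iff)

text \<open>Step 1 reconstructs \<open>x 0\<close> itself, without kernel noise, so its optimal
  variance is the bare estimation error per dimension. It is a separate case because
  \<open>trajectory\<close> does not fix \<open>tau 0\<close>.\<close>

definition opt :: "nat \<Rightarrow> real" where
  "opt k = (if k = 1 then mmse (sqrt (abar beta 1)) (bbar beta 1) / real CARD('d)
     else sigma_star_sq beta lam q0 (tau (k - 1)) (tau k))"

lemma opt_pos: "1 \<le> k \<Longrightarrow> k \<le> K \<Longrightarrow> 0 < opt k"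
  using sigma_star_pos[of k] mmse_pos[of "bbar beta 1"] B_pos[of 1] tau_1 by (simp add: opt_def)

section \<open>The log-ratio for fixed reverse parameters\<close>

context
  fixes mu :: "nat \<Rightarrow> real^'d \<Rightarrow> real^'d" and sig :: "nat \<Rightarrow> real"
  assumes params: "rev_params K mu sig"
begin

definition dev :: "nat \<Rightarrow> ennreal" where
  "dev k = (\<integral>\<^sup>+x. ennreal ((norm (x (k - 1) - mu k (x k)))\<^sup>2) \<partial>P)"

lemma sig_pos: "1 \<le> k \<Longrightarrow> k \<le> K \<Longrightarrow> 0 < sig k"
  and mu_meas: "1 \<le> k \<Longrightarrow> k \<le> K \<Longrightarrow> mu k \<in> borel_measurable borel"
  using params by (auto simp: rev_params_def)

lemma rev_meas: "rev_joint K mu sig \<in> borel_measurable \<Omega>"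
  unfolding rev_joint_def
  by (intro borel_measurable_times borel_measurable_prod borel_measurable_gauss_pdf
      measurable_compose[OF coord_meas(2) mu_meas] coord_meas) auto

lemma rev_pos: "0 < rev_joint K mu sig x"
  unfolding rev_joint_def using sig_pos
  by (intro mult_pos_pos prod_pos gauss_pdf_pos) auto

definition log_norm_const :: real where
  "log_norm_const = real CARD('d) / 2 * (ln (2 * pi) - ln (2 * pi * bbar beta N)
     - (\<Sum>k\<in>{2..K}. ln (2 * pi * \<Lambda> k)) + (\<Sum>k\<in>{1..K}. ln (2 * pi * sig k)))"

text \<open>Collects the terms of the log-ratio with finite expectation, none of which involves
  \<open>mu\<close>; \<open>Q\<close> takes the nonnegative rest. The two parts of
  \<open>ln q0\<close> are shared out accordingly.\<close>

definition R :: "(nat \<Rightarrow> real^'d) \<Rightarrow> real" where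
  "R x = log_norm_const - max 0 (- ln (q0 (x 0)))
     - (\<Sum>k\<in>{2..K}. (norm (x (k - 1) - mt k (x k) (x 0)))\<^sup>2 / (2 * \<Lambda> k))
     - (norm (x K - sqrt (abar beta N) *\<^sub>R x 0))\<^sup>2 / (2 * bbar beta N) + (norm (x K))\<^sup>2 / 2"

definition Q :: "(nat \<Rightarrow> real^'d) \<Rightarrow> real" where
  "Q x = max 0 (ln (q0 (x 0))) + (\<Sum>k\<in>{1..K}. (norm (x (k - 1) - mu k (x k)))\<^sup>2 / (2 * sig k))"

lemma rev_dev_meas:
  assumes k: "k \<in> {1..K}"
  shows "(\<lambda>x. (norm (x (k - 1) - mu k (x k)))\<^sup>2) \<in> borel_measurable \<Omega>"
    and "(\<lambda>x. (norm (x (k - 1) - mu k (x k)))\<^sup>2) \<in> borel_measurable P"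
proof -
  have [measurable]: "(\<lambda>x. x (k - 1)) \<in> borel_measurable \<Omega>" "(\<lambda>x. mu k (x k)) \<in> borel_measurable \<Omega>"
    using k by (auto intro!: coord_meas measurable_compose[OF coord_meas(2) mu_meas])
  show "(\<lambda>x. (norm (x (k - 1) - mu k (x k)))\<^sup>2) \<in> borel_measurable \<Omega>"
    by measurable
  then show "(\<lambda>x. (norm (x (k - 1) - mu k (x k)))\<^sup>2) \<in> borel_measurable P"
    using measurable_cong_sets[OF sets_P refl] by blast
qed

lemma bbar_N_pos: "0 < bbar beta N" and abar_N_pos: "0 < abar beta N"
  using B_pos[of K] A_pos[of K] K_pos tau_K by auto

lemma ln_ratio:
  assumes f: "0 < fwd_joint beta lam N K tau q0 x"
  shows "ln (fwd_joint beta lam N K tau q0 x / rev_joint K mu sig x) = R x + Q x"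
proof -
  define F where "F = (\<Prod>k\<in>{2..K}. gauss_pdf (mt k (x k) (x 0)) (\<Lambda> k) (x (k - 1)))"
  define G where "G = (\<Prod>k\<in>{1..K}. gauss_pdf (mu k (x k)) (sig k) (x (k - 1)))"
  have F: "0 < F" unfolding F_def using \<Lambda>_pos by (intro prod_pos gauss_pdf_pos) auto
  have G: "0 < G" unfolding G_def using sig_pos by (intro prod_pos gauss_pdf_pos) auto
  have gN: "0 < gauss_pdf (sqrt (abar beta N) *\<^sub>R x 0) (bbar beta N) (x K)"
    by (rule gauss_pdf_pos[OF bbar_N_pos])
  have g1: "0 < gauss_pdf 0 1 (x K)" by (simp add: gauss_pdf_pos)
  have fe: "fwd_joint beta lam N K tau q0 x
      = q0 (x 0) * gauss_pdf (sqrt (abar beta N) *\<^sub>R x 0) (bbar beta N) (x K) * F"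
    by (simp only: fwd_joint_def F_def)
  \<comment> \<open>Positivity of the joint density forces \<open>q0 (x 0)\<close> to be positive,
    without which the logarithm of the product would not split.\<close>
  have q: "0 < q0 (x 0)"
    using f q0_nonneg[of "x 0"] unfolding fe by (cases "q0 (x 0) = 0") auto
  have lnF: "ln F = (\<Sum>k\<in>{2..K}. - (real CARD('d) / 2 * ln (2 * pi * \<Lambda> k))
      - (norm (x (k - 1) - mt k (x k) (x 0)))\<^sup>2 / (2 * \<Lambda> k))"
    unfolding F_def using \<Lambda>_pos
    by (subst ln_prod) (auto intro!: sum.cong gauss_pdf_pos simp: ln_gauss_pdf gauss_pdf_nonzero simp del: One_nat_def)
  have lnG: "ln G = (\<Sum>k\<in>{1..K}. - (real CARD('d) / 2 * ln (2 * pi * sig k))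
      - (norm (x (k - 1) - mu k (x k)))\<^sup>2 / (2 * sig k))"
    unfolding G_def using sig_pos
    by (subst ln_prod) (auto intro!: sum.cong gauss_pdf_pos simp: ln_gauss_pdf gauss_pdf_nonzero simp del: One_nat_def)
  have "ln (fwd_joint beta lam N K tau q0 x / rev_joint K mu sig x)
      = ln (q0 (x 0)) + ln (gauss_pdf (sqrt (abar beta N) *\<^sub>R x 0) (bbar beta N) (x K)) + ln F
        - (ln (gauss_pdf 0 1 (x K)) + ln G)"
    using q gN g1 F G unfolding fe rev_joint_def G_def[symmetric]
    by (simp add: ln_div ln_mult)
  also have "ln (q0 (x 0)) = max 0 (ln (q0 (x 0))) - max 0 (- ln (q0 (x 0)))"
    by (simp add: max_def)
  finally show ?thesis
    unfolding R_def Q_def log_norm_const_def lnF lnG ln_gauss_pdf[OF bbar_N_pos] ln_gauss_pdf[OF zero_less_one]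
    by (simp only: sum_subtractf sum_negf sum_distrib_left[symmetric] ring_distribs diff_zero) simp
qed

text \<open>Each forward quadratic is normalised by its own variance, so its expectation is
  \<open>d / 2\<close> whatever \<open>lam\<close> is.\<close>

lemma R_integral:
  "has_bochner_integral P R (log_norm_const - negent - (\<Sum>k\<in>{2..K}. real CARD('d) / 2) - real CARD('d) / 2
    + (bbar beta N * real CARD('d) + abar beta N * (\<integral>x. q0 x * (norm x)\<^sup>2 \<partial>lborel)) / 2)"
proof -
  interpret prob_space P by (rule prob_P)
  have M2: "0 \<le> (\<integral>x. q0 x * (norm x)\<^sup>2 \<partial>lborel)" by (simp add: q0_nonneg)
  have 0: "has_bochner_integral P (\<lambda>_. log_norm_const) log_norm_const"
    by (simp add: has_bochner_integral_iff prob_space)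
  have 1: "has_bochner_integral P (\<lambda>x. max 0 (- ln (q0 (x 0)))) negent"
  proof (rule has_bochner_integral_P_nonneg)
    show "(\<lambda>x. max 0 (- ln (q0 (x 0)))) \<in> borel_measurable P"
      using coord_meas(1)[of 0] by measurable
    show "(\<integral>\<^sup>+x. ennreal (max 0 (- ln (q0 (x 0)))) \<partial>P) = ennreal negent"
      using nn_integral_P_first[of "\<lambda>x. ennreal (- ln (q0 x))"] nn_integral_negent
      by (simp add: ennreal_max_0')
  qed (auto simp: negent_def)
  have 2: "has_bochner_integral P (\<lambda>x. (norm (x (k - 1) - mt k (x k) (x 0)))\<^sup>2 / (2 * \<Lambda> k)) (real CARD('d) / 2)"
    if k: "k \<in> {2..K}" for k
  proof -
    have [measurable]: "(\<lambda>x. x (k - 1)) \<in> borel_measurable P" "(\<lambda>x. x k) \<in> borel_measurable P"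
        "(\<lambda>x. x 0) \<in> borel_measurable P"
      using k by (auto intro!: coord_meas)
    have "(\<lambda>x. (norm (x (k - 1) - mt k (x k) (x 0)))\<^sup>2) \<in> borel_measurable P"
      unfolding mt_eq by measurable
    then have "has_bochner_integral P (\<lambda>x. (norm (x (k - 1) - mt k (x k) (x 0)))\<^sup>2) (\<Lambda> k * real CARD('d))"
      using k by (intro has_bochner_integral_P_nonneg nn_integral_P_fwd_dev) (auto simp del: One_nat_def)
    then have "has_bochner_integral P (\<lambda>x. (norm (x (k - 1) - mt k (x k) (x 0)))\<^sup>2 / (2 * \<Lambda> k))
        (\<Lambda> k * real CARD('d) / (2 * \<Lambda> k))"
      by (rule has_bochner_integral_divide_zero)
    then show ?thesis using \<Lambda>_pos[of k] k by simp
  qed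
  have [measurable]: "(\<lambda>x. x K) \<in> borel_measurable P" "(\<lambda>x. x 0) \<in> borel_measurable P"
    by (auto intro: coord_meas)
  have "has_bochner_integral P (\<lambda>x. (norm (x K - sqrt (abar beta N) *\<^sub>R x 0))\<^sup>2) (bbar beta N * real CARD('d))"
    using bbar_N_pos by (intro has_bochner_integral_P_nonneg nn_integral_P_last_dev) auto
  then have "has_bochner_integral P (\<lambda>x. (norm (x K - sqrt (abar beta N) *\<^sub>R x 0))\<^sup>2 / (2 * bbar beta N))
      (bbar beta N * real CARD('d) / (2 * bbar beta N))"
    by (rule has_bochner_integral_divide_zero)
  then have 3: "has_bochner_integral P (\<lambda>x. (norm (x K - sqrt (abar beta N) *\<^sub>R x 0))\<^sup>2 / (2 * bbar beta N))
      (real CARD('d) / 2)" using bbar_N_pos by simp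
  have "has_bochner_integral P (\<lambda>x. (norm (x K))\<^sup>2)
      (bbar beta N * real CARD('d) + abar beta N * (\<integral>x. q0 x * (norm x)\<^sup>2 \<partial>lborel))"
    using bbar_N_pos abar_N_pos M2
    by (intro has_bochner_integral_P_nonneg nn_integral_P_last) (auto intro!: add_nonneg_nonneg mult_nonneg_nonneg)
  then have 4: "has_bochner_integral P (\<lambda>x. (norm (x K))\<^sup>2 / 2)
      ((bbar beta N * real CARD('d) + abar beta N * (\<integral>x. q0 x * (norm x)\<^sup>2 \<partial>lborel)) / 2)"
    by (rule has_bochner_integral_divide_zero)
  show ?thesis
    unfolding R_def [abs_def]
    by (intro has_bochner_integral_add has_bochner_integral_diff has_bochner_integral_sum 0 1 2 3 4)
qed

lemma Q_meas: "Q \<in> borel_measurable \<Omega>"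
  unfolding Q_def[abs_def]
  by (intro borel_measurable_add borel_measurable_sum borel_measurable_divide rev_dev_meas
      borel_measurable_max borel_measurable_ln measurable_compose[OF _ q0_meas] coord_meas
      borel_measurable_const) auto

lemma Q_nonneg: "0 \<le> Q x"
  unfolding Q_def using sig_pos
  by (intro add_nonneg_nonneg sum_nonneg divide_nonneg_nonneg) (auto intro: less_imp_le)

lemma Q_integral:
  "(\<integral>\<^sup>+x. ennreal (Q x) \<partial>P) = posent + (\<Sum>k\<in>{1..K}. ennreal (1 / (2 * sig k)) * dev k)"
proof -
  have m: "(\<lambda>x. ennreal (1 / (2 * sig k)) * ennreal ((norm (x (k - 1) - mu k (x k)))\<^sup>2))
      \<in> borel_measurable P" if "k \<in> {1..K}" for k
    by (intro borel_measurable_times_ennreal borel_measurable_const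
        measurable_compose[OF rev_dev_meas(2)[OF that] measurable_ennreal])
  have m0: "(\<lambda>x. ennreal (ln (q0 (x 0)))) \<in> borel_measurable P"
    using coord_meas(1)[of 0] by measurable
  have "(\<integral>\<^sup>+x. ennreal (Q x) \<partial>P) = (\<integral>\<^sup>+x. ennreal (ln (q0 (x 0))) +
      (\<Sum>k\<in>{1..K}. ennreal (1 / (2 * sig k)) * ennreal ((norm (x (k - 1) - mu k (x k)))\<^sup>2)) \<partial>P)"
  proof (rule nn_integral_cong)
    fix x
    have s: "(\<Sum>k\<in>{1..K}. ennreal (1 / (2 * sig k)) * ennreal ((norm (x (k - 1) - mu k (x k)))\<^sup>2))
        = ennreal (\<Sum>k\<in>{1..K}. (norm (x (k - 1) - mu k (x k)))\<^sup>2 / (2 * sig k))"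
      using sig_pos
      by (subst sum_ennreal[symmetric])
        (auto intro!: sum.cong divide_nonneg_nonneg simp: ennreal_mult'[symmetric] less_imp_le simp del: One_nat_def)
    have "ennreal (Q x) = ennreal (max 0 (ln (q0 (x 0))))
        + ennreal (\<Sum>k\<in>{1..K}. (norm (x (k - 1) - mu k (x k)))\<^sup>2 / (2 * sig k))"
      unfolding Q_def using sig_pos
      by (intro ennreal_plus sum_nonneg divide_nonneg_nonneg) (auto simp: less_imp_le)
    then show "ennreal (Q x) = ennreal (ln (q0 (x 0))) +
      (\<Sum>k\<in>{1..K}. ennreal (1 / (2 * sig k)) * ennreal ((norm (x (k - 1) - mu k (x k)))\<^sup>2))"
      unfolding s by simp
  qed
  also have "\<dots> = (\<integral>\<^sup>+x. ennreal (ln (q0 (x 0))) \<partial>P)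
      + (\<Sum>k\<in>{1..K}. ennreal (1 / (2 * sig k)) * dev k)"
  proof -
    have c: "(\<integral>\<^sup>+x. ennreal (1 / (2 * sig k)) * ennreal ((norm (x (k - 1) - mu k (x k)))\<^sup>2) \<partial>P)
        = ennreal (1 / (2 * sig k)) * dev k" if "k \<in> {1..K}" for k
      unfolding dev_def
      by (rule nn_integral_cmult[OF measurable_compose[OF rev_dev_meas(2)[OF that] measurable_ennreal]])
    have ms: "(\<lambda>x. \<Sum>k\<in>{1..K}. ennreal (1 / (2 * sig k)) * ennreal ((norm (x (k - 1) - mu k (x k)))\<^sup>2))
        \<in> borel_measurable P"
      by (rule borel_measurable_sum) (rule m)
    show ?thesis
      unfolding nn_integral_add[OF m0 ms]
      by (intro arg_cong2[where f = "(+)"] refl trans[OF nn_integral_sum[OF m]] sum.cong c)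
  qed
  also have "(\<integral>\<^sup>+x. ennreal (ln (q0 (x 0))) \<partial>P) = posent"
    unfolding posent_def by (rule nn_integral_P_first) simp
  finally show ?thesis .
qed

abbreviation kl_smooth :: real where
  "kl_smooth \<equiv> log_norm_const - negent - (\<Sum>k\<in>{2..K}. real CARD('d) / 2) - real CARD('d) / 2
    + (bbar beta N * real CARD('d) + abar beta N * (\<integral>x. q0 x * (norm x)\<^sup>2 \<partial>lborel)) / 2"

lemma KL_eq:
  "KL_div \<Omega> (fwd_joint beta lam N K tau q0) (rev_joint K mu sig)
    = ereal kl_smooth + enn2ereal (posent + (\<Sum>k\<in>{1..K}. ennreal (1 / (2 * sig k)) * dev k))"
proof -
  have f: "0 \<le> fwd_joint beta lam N K tau q0 x" for x
    unfolding fwd_joint_def by (intro mult_nonneg_nonneg prod_nonneg q0_nonneg gauss_pdf_nonneg)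
  have "AE x in P. ln (fwd_joint beta lam N K tau q0 x / rev_joint K mu sig x) = R x + Q x"
    unfolding P_def by (subst AE_density) (auto intro!: AE_I2 ln_ratio)
  then have "KL_div \<Omega> (fwd_joint beta lam N K tau q0) (rev_joint K mu sig)
      = ereal (integral\<^sup>L P R) + enn2ereal (\<integral>\<^sup>+x. ennreal (Q x) \<partial>P)"
    using R_integral unfolding P_def
    by (intro KL_div_density fwd_meas rev_meas Q_meas f rev_pos Q_nonneg) (auto simp: has_bochner_integral_iff)
  then show ?thesis
    using R_integral Q_integral by (simp only: has_bochner_integral_iff)
qed

lemma sum_ennreal_sig:
  "(\<Sum>k\<in>{1..K}. ennreal (1 / (2 * sig k)) * ennreal (real CARD('d) * opt k))
    = ennreal (\<Sum>k\<in>{1..K}. real CARD('d) * opt k / (2 * sig k))"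
  using sig_pos opt_pos
  by (subst sum_ennreal[symmetric])
    (auto intro!: sum.cong divide_nonneg_nonneg simp: ennreal_mult'[symmetric] less_imp_le)

text \<open>The last sum measures how far each \<open>ln s + v / s\<close> lies above its minimum
  \<open>ln v + 1\<close>. The \<open>K\<close> ones in it match the \<open>K\<close> forward halves
  of \<open>d\<close>; pairing \<open>ln (opt k)\<close> with \<open>ln (\<Lambda> k)\<close> gives
  \<open>Jcost\<close> for \<open>k \<ge> 2\<close>, and the unpaired \<open>opt 1\<close> goes to
  \<open>kl_const\<close>.\<close>

lemma kl_smooth_eq:
  "kl_smooth + (\<Sum>k\<in>{1..K}. real CARD('d) * opt k / (2 * sig k))
    = real CARD('d) / 2 * (\<Sum>k\<in>{2..K}. Jcost beta lam q0 (tau (k - 1)) (tau k)) + kl_const beta N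
      + real CARD('d) / 2 * (\<Sum>k\<in>{1..K}. ln (sig k) + opt k / sig k - (ln (opt k) + 1))"
proof -
  have split: "sum h {1..K} = h 1 + sum h {2..K}" for h :: "nat \<Rightarrow> real"
    using K_pos by (simp add: sum.atLeast_Suc_atMost numeral_2_eq_2)
  have J: "Jcost beta lam q0 (tau (k - 1)) (tau k) = ln (opt k) - ln (\<Lambda> k)" if "k \<in> {2..K}" for k
    using that \<Lambda>_pos[of k] sigma_star_pos[of k] by (auto simp: Jcost_def opt_def ln_div)
  have o1: "opt 1 = mmse (sqrt (abar beta 1)) (bbar beta 1) / real CARD('d)" by (simp add: opt_def)
  have lp: "ln (2 * pi * s) = ln (2 * pi) + ln s" if "0 < s" for s :: real
    using that by (simp add: ln_mult)
  have L: "(\<Sum>k\<in>{2..K}. ln (2 * pi * \<Lambda> k)) = (\<Sum>k\<in>{2..K}. ln (2 * pi) + ln (\<Lambda> k))"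
    using \<Lambda>_pos by (intro sum.cong refl lp) auto
  have S: "(\<Sum>k\<in>{1..K}. ln (2 * pi * sig k)) = (\<Sum>k\<in>{1..K}. ln (2 * pi) + ln (sig k))"
    using sig_pos by (intro sum.cong refl lp) auto
  have JS: "(\<Sum>k\<in>{2..K}. Jcost beta lam q0 (tau (k - 1)) (tau k)) = (\<Sum>k\<in>{2..K}. ln (opt k) - ln (\<Lambda> k))"
    by (intro sum.cong refl J)
  have V: "(\<Sum>k\<in>{1..K}. real CARD('d) * opt k / (2 * sig k)) = real CARD('d) / 2 * (\<Sum>k\<in>{1..K}. opt k / sig k)"
    by (simp add: sum_distrib_left)
  have D: "(\<Sum>k\<in>{2..K}. real CARD('d) / 2) = real CARD('d) / 2 * (\<Sum>k\<in>{2..K}. 1)"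
    by (simp only: sum_distrib_left mult_1_right)
  show ?thesis
    unfolding log_norm_const_def kl_const_def o1[symmetric] lp[OF opt_pos[OF order_refl K_pos]] L S JS V D split
      sum.distrib sum_subtractf
    by (simp add: algebra_simps del: sum_constant)
qed

text \<open>Two losses are discarded: the remainder of each expected deviation above
  \<open>d * opt k\<close>, and the gap in \<open>ln_plus_ratio_ge\<close>.
  \<open>KL_attained\<close> is the case in which both are zero.\<close>

lemma KL_lower:
  "ereal (real CARD('d) / 2 * (\<Sum>k\<in>{2..K}. Jcost beta lam q0 (tau (k - 1)) (tau k)))
      + (ereal (kl_const beta N) + enn2ereal posent)
    \<le> KL_div \<Omega> (fwd_joint beta lam N K tau q0) (rev_joint K mu sig)"
proof -
  have dev: "ennreal (real CARD('d) * opt k) \<le> dev k" if k: "k \<in> {1..K}" for k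
  proof (cases "k = 1")
    case True
    then show ?thesis
      using nn_integral_P_rev_dev_first[OF mu_meas[of 1]] K_pos
      by (simp add: dev_def opt_def)
  next
    case False
    then have "2 \<le> k" using k by auto
    then show ?thesis
      using nn_integral_P_rev_dev[OF _ _ mu_meas, of k k] k False
      by (simp add: dev_def opt_def)
  qed
  let ?s = "\<Sum>k\<in>{1..K}. real CARD('d) * opt k / (2 * sig k)"
  have s0: "0 \<le> ?s"
    using sig_pos opt_pos by (intro sum_nonneg divide_nonneg_nonneg) (auto simp: less_imp_le)
  have "0 \<le> (\<Sum>k\<in>{1..K}. ln (sig k) + opt k / sig k - (ln (opt k) + 1))"
    using ln_plus_ratio_ge sig_pos opt_pos by (intro sum_nonneg) auto
  then have "real CARD('d) / 2 * (\<Sum>k\<in>{2..K}. Jcost beta lam q0 (tau (k - 1)) (tau k)) + kl_const beta N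
      \<le> kl_smooth + ?s"
    unfolding kl_smooth_eq by simp
  then have "ereal (real CARD('d) / 2 * (\<Sum>k\<in>{2..K}. Jcost beta lam q0 (tau (k - 1)) (tau k)))
      + (ereal (kl_const beta N) + enn2ereal posent) \<le> ereal (kl_smooth + ?s) + enn2ereal posent"
    unfolding add.assoc[symmetric] plus_ereal.simps(1)
    by (intro add_right_mono) simp
  also have "\<dots> = ereal kl_smooth + enn2ereal (posent + ennreal ?s)"
    using s0 by (simp add: plus_ennreal.rep_eq ac_simps flip: plus_ereal.simps(1))
  also have "\<dots> \<le> ereal kl_smooth + enn2ereal (posent + (\<Sum>k\<in>{1..K}. ennreal (1 / (2 * sig k)) * dev k))"
    unfolding sum_ennreal_sig[symmetric]
    by (intro add_left_mono iffD1[OF less_eq_ennreal.rep_eq] sum_mono mult_left_mono dev) auto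
  finally show ?thesis unfolding KL_eq .
qed

lemma KL_attained:
  assumes sig: "\<And>k. k \<in> {1..K} \<Longrightarrow> sig k = opt k"
    and dev: "\<And>k. k \<in> {1..K} \<Longrightarrow> dev k = ennreal (real CARD('d) * opt k)"
  shows "KL_div \<Omega> (fwd_joint beta lam N K tau q0) (rev_joint K mu sig)
    = ereal (real CARD('d) / 2 * (\<Sum>k\<in>{2..K}. Jcost beta lam q0 (tau (k - 1)) (tau k)))
      + (ereal (kl_const beta N) + enn2ereal posent)"
proof -
  let ?s = "\<Sum>k\<in>{1..K}. real CARD('d) * opt k / (2 * sig k)"
  have s0: "0 \<le> ?s"
    using sig_pos opt_pos by (intro sum_nonneg divide_nonneg_nonneg) (auto simp: less_imp_le)
  have "opt k / opt k = 1" if "k \<in> {1..K}" for k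
    using opt_pos[of k] that by simp
  then have z: "(\<Sum>k\<in>{1..K}. ln (sig k) + opt k / sig k - (ln (opt k) + 1)) = 0"
    using sig by (intro sum.neutral) auto
  have "KL_div \<Omega> (fwd_joint beta lam N K tau q0) (rev_joint K mu sig) = ereal kl_smooth + enn2ereal (posent + ennreal ?s)"
    unfolding KL_eq sum_ennreal_sig[symmetric] by (simp add: dev)
  also have "\<dots> = ereal (kl_smooth + ?s) + enn2ereal posent"
    using s0 by (simp add: plus_ennreal.rep_eq ac_simps flip: plus_ereal.simps(1))
  finally show ?thesis
    unfolding kl_smooth_eq z by (simp add: add.assoc flip: plus_ereal.simps(1))
qed

end

lemma KL_min_exists:
  "\<exists>mu sig. rev_params K mu sig \<and>
     KL_div \<Omega> (fwd_joint beta lam N K tau q0) (rev_joint K mu sig)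
    = ereal (real CARD('d) / 2 * (\<Sum>k\<in>{2..K}. Jcost beta lam q0 (tau (k - 1)) (tau k)))
      + (ereal (kl_const beta N) + enn2ereal posent)"
proof -
  \<comment> \<open>The conditional expectation of \<open>x (k - 1)\<close> given
    \<open>x k\<close>, which annihilates the remainder in the expected deviations.\<close>
  define mu where "mu k y = (if k = 1 then pmean (sqrt (abar beta 1)) (bbar beta 1) y
     else cx k *\<^sub>R y + c0 k *\<^sub>R pmean (sqrt (A k)) (B k) y)" for k y
  have m: "mu k \<in> borel_measurable borel" for k
    unfolding mu_def[abs_def] by measurable
  have p: "rev_params K mu opt"
    using opt_pos m by (auto simp: rev_params_def)
  have "dev mu k = ennreal (real CARD('d) * opt k)" if k: "k \<in> {1..K}" for k
  proof (cases "k = 1")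
    case True
    then show ?thesis
      using nn_integral_P_rev_dev_first[OF m[of 1]]
      by (simp add: dev_def[OF p] opt_def mu_def)
  next
    case False
    then have "2 \<le> k" using k by auto
    then show ?thesis
      using nn_integral_P_rev_dev[OF _ _ m, of k k] k False
      by (simp add: dev_def[OF p] opt_def mu_def)
  qed
  then show ?thesis
    using KL_attained[OF p] p by blast
qed

end

theorem theorem3:
  fixes beta :: "nat \<Rightarrow> real" and N :: nat and lam :: "nat \<Rightarrow> nat \<Rightarrow> real"
    and q0 :: "real^'d \<Rightarrow> real"
  assumes "1 \<le> N"
    and "\<forall>n\<in>{1..N}. 0 < beta n \<and> beta n < 1"
    and "\<forall>s t. 1 \<le> s \<and> s < t \<and> t \<le> N \<longrightarrow> 0 < (lam s t)\<^sup>2 \<and> (lam s t)\<^sup>2 \<le> bbar beta s"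
    and "q0 \<in> borel_measurable lborel"
    and "\<forall>x. 0 \<le> q0 x"
    and "(\<integral>\<^sup>+ x. ennreal (q0 x) \<partial>lborel) = 1"
    and "(\<integral>\<^sup>+ x. ennreal (q0 x * (norm x)\<^sup>2) \<partial>lborel) < \<infinity>"
  shows "\<exists>c::ereal. \<forall>K tau. trajectory N K tau \<longrightarrow>
     (\<exists>mu sig. rev_params K mu sig \<and>
        KL_div (PiM {0..K} (\<lambda>_. lborel :: (real^'d) measure)) (fwd_joint beta lam N K tau q0) (rev_joint K mu sig)
        = ereal (real CARD('d) / 2 * (\<Sum>k\<in>{2..K}. Jcost beta lam q0 (tau (k - 1)) (tau k))) + c)
   \<and> (\<forall>mu sig. rev_params K mu sig \<longrightarrow>
        ereal (real CARD('d) / 2 * (\<Sum>k\<in>{2..K}. Jcost beta lam q0 (tau (k - 1)) (tau k))) + c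
        \<le> KL_div (PiM {0..K} (\<lambda>_. lborel :: (real^'d) measure)) (fwd_joint beta lam N K tau q0) (rev_joint K mu sig))"
proof -
  interpret data_density q0
    using assms(4-7) by unfold_locales auto
  \<comment> \<open>The witness is fixed before \<open>K\<close> and \<open>tau\<close>, and it is
    infinite exactly when \<open>posent\<close> is.\<close>
  show ?thesis
  proof (intro exI[of _ "ereal (kl_const beta N) + enn2ereal posent"] allI impI)
    fix K :: nat and tau
    assume "trajectory N K tau"
    then interpret diffusion q0 beta N lam K tau
      using assms(2,3) by unfold_locales auto
    show "(\<exists>mu sig. rev_params K mu sig \<and>
        KL_div (PiM {0..K} (\<lambda>_. lborel :: (real^'d) measure)) (fwd_joint beta lam N K tau q0) (rev_joint K mu sig)
        = ereal (real CARD('d) / 2 * (\<Sum>k\<in>{2..K}. Jcost beta lam q0 (tau (k - 1)) (tau k))) + (ereal (kl_const beta N) + enn2ereal posent))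
   \<and> (\<forall>mu sig. rev_params K mu sig \<longrightarrow>
        ereal (real CARD('d) / 2 * (\<Sum>k\<in>{2..K}. Jcost beta lam q0 (tau (k - 1)) (tau k))) + (ereal (kl_const beta N) + enn2ereal posent)
        \<le> KL_div (PiM {0..K} (\<lambda>_. lborel :: (real^'d) measure)) (fwd_joint beta lam N K tau q0) (rev_joint K mu sig))"
      using KL_min_exists KL_lower by blast
  qed
qed

end
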